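(* Let $M$ be a split matroid of rank $r$ and let $A$ and $B$ be bases of $M$. Then there are orderings $A=(a_1,\dots,a_r)$ and $B=(b_1,\dots,b_r)$ of the elements of $A$ and $B$ such that $\{a_1,\dots,a_i,b_{i+1},\dots,b_r\}$ and $\{b_1,\dots,b_i,a_{i+1},\dots,a_r\}$ are bases of $M$ for every $i=0,\dots,r$.
   Context: All matroids are on finite ground sets; $X-Y$ denotes set difference. Elementary split matroid: let $S$ be a finite set, $r,r_1,\dots,r_q$ ($q\ge 0$) non-negative integers with $|S|\ge r$, and $H_1,\dots,H_q\subseteq S$ subsets such that $|H_i\cap H_j|\le r_i+r_j-r$ for all $1\le i<j\le q$, and $|S-H_i|+r_i\ge r$ for all $i$. Then $\{X\subseteq S : |X|\le r,\ |X\cap H_i|\le r_i \text{ for } 1\le i\le q\}$ is the family of independent sets of a rank-$r$ matroid on $S$; matroids arising this way are called elementary split matroids. Split matroid: a matroid is a split matroid if at most one of its connected components is a non-uniform matroid, and this component, if it exists, is an elementary split matroid (all other components being uniform matroids). *)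

theory Defs
  imports Main
begin

text \<open>
  A matroid is given by its ground set \<open>S\<close> and its independence predicate \<open>I\<close>.
  All constants below take \<open>I\<close> as a predicate that is false on sets not contained in \<open>S\<close>.
\<close>

locale matroid =
  fixes S :: "'a set" and I :: "'a set \<Rightarrow> bool"
  assumes finite_ground: "finite S"
    and indep_subset_ground: "I X \<Longrightarrow> X \<subseteq> S"
    and indep_empty: "I {}"
    and indep_subset: "I X \<Longrightarrow> Y \<subseteq> X \<Longrightarrow> I Y"
    and augment: "I X \<Longrightarrow> I Y \<Longrightarrow> card X < card Y \<Longrightarrow> \<exists>y\<in>Y - X. I (insert y X)"

definition basis :: "('a set \<Rightarrow> bool) \<Rightarrow> 'a set \<Rightarrow> bool" where
  "basis I B \<longleftrightarrow> I B \<and> (\<forall>X. I X \<and> B \<subseteq> X \<longrightarrow> X = B)"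

definition matroid_rank :: "('a set \<Rightarrow> bool) \<Rightarrow> nat" where
  "matroid_rank I = Max {card X | X. I X}"

definition circuit :: "'a set \<Rightarrow> ('a set \<Rightarrow> bool) \<Rightarrow> 'a set \<Rightarrow> bool" where
  "circuit S I C \<longleftrightarrow> C \<subseteq> S \<and> \<not> I C \<and> (\<forall>X. X \<subset> C \<longrightarrow> I X)"

definition restriction :: "('a set \<Rightarrow> bool) \<Rightarrow> 'a set \<Rightarrow> 'a set \<Rightarrow> bool" where
  "restriction I K X \<longleftrightarrow> X \<subseteq> K \<and> I X"

definition connected_rel :: "'a set \<Rightarrow> ('a set \<Rightarrow> bool) \<Rightarrow> ('a \<times> 'a) set" where
  "connected_rel S I =
    {(x, y). x \<in> S \<and> y \<in> S \<and> (x = y \<or> (\<exists>C. circuit S I C \<and> x \<in> C \<and> y \<in> C))}"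

text \<open>
  For a matroid, \<^term>\<open>connected_rel S I\<close> is an equivalence relation on \<open>S\<close>.  Its classes are the
  ground sets of the connected components; the component with ground set \<open>K\<close> is the
  matroid \<^term>\<open>restriction I K\<close> on \<open>K\<close>.
\<close>

definition components :: "'a set \<Rightarrow> ('a set \<Rightarrow> bool) \<Rightarrow> 'a set set" where
  "components S I = S // connected_rel S I"

definition uniform_matroid :: "'a set \<Rightarrow> ('a set \<Rightarrow> bool) \<Rightarrow> bool" where
  "uniform_matroid S I \<longleftrightarrow>
    finite S \<and> (\<exists>k\<le>card S. \<forall>X. I X \<longleftrightarrow> X \<subseteq> S \<and> card X \<le> k)"

text \<open>
  The bound $|H_i \cap H_j| \le r_i + r_j - r$ is an inequality of integers, so \<open>r\<close> is moved to
  the left to avoid truncated subtraction.  The function \<open>\<rho>\<close> stands for $i \mapsto r_i$.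
\<close>

definition elementary_split_matroid :: "'a set \<Rightarrow> ('a set \<Rightarrow> bool) \<Rightarrow> bool" where
  "elementary_split_matroid S I \<longleftrightarrow>
    finite S \<and>
    (\<exists>(r::nat) (q::nat) (\<rho>::nat \<Rightarrow> nat) (H::nat \<Rightarrow> 'a set).
      r \<le> card S \<and>
      (\<forall>i\<in>{1..q}. H i \<subseteq> S) \<and>
      (\<forall>i\<in>{1..q}. \<forall>j\<in>{1..q}. i < j \<longrightarrow> card (H i \<inter> H j) + r \<le> \<rho> i + \<rho> j) \<and>
      (\<forall>i\<in>{1..q}. r \<le> card (S - H i) + \<rho> i) \<and>
      (\<forall>X. I X \<longleftrightarrow> X \<subseteq> S \<and> card X \<le> r \<and> (\<forall>i\<in>{1..q}. card (X \<inter> H i) \<le> \<rho> i)))"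

definition split_matroid :: "'a set \<Rightarrow> ('a set \<Rightarrow> bool) \<Rightarrow> bool" where
  "split_matroid S I \<longleftrightarrow>
    matroid S I \<and>
    (\<forall>K\<in>components S I. \<forall>L\<in>components S I.
      \<not> uniform_matroid K (restriction I K) \<and> \<not> uniform_matroid L (restriction I L)
        \<longrightarrow> K = L) \<and>
    (\<forall>K\<in>components S I.
      \<not> uniform_matroid K (restriction I K) \<longrightarrow> elementary_split_matroid K (restriction I K))"

end

theory Submission
  imports Defs
begin

text \<open>
  Every component of a split matroid is an elementary split matroid, since a uniform matroid is one
  without any bounded sets \<open>H\<^sub>i\<close>.  A set is independent iff each of its intersections with the components is
  (\<open>indep_Un_separated\<close>), so orderings found in the components can be concatenated
  (\<open>serial_exchange_append\<close>).  In an elementary split matroid, contracting \<open>A \<inter> B\<close> gives a system of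
  the same kind, so the bases \<open>A\<close> and \<open>B\<close> may be taken disjoint.

  For disjoint bases, the pair \<open>(A, B)\<close> is turned into \<open>(B, A)\<close> by one symmetric exchange after another,
  each moving elements that have not moved before.  After some steps the pair is
  \<open>(Z \<union> P, W \<union> Q)\<close> and the goal is \<open>(Z \<union> Q, W \<union> P)\<close>.
  Exchanging \<open>p \<in> P\<close> with \<open>q \<in> Q\<close> fails only if \<open>Z \<union> P\<close> attains the bound of some \<open>H\<^sub>i\<close> with \<open>q\<close> inside and
  \<open>p\<close> outside, or \<open>W \<union> Q\<close> attains that of some \<open>H\<^sub>i\<close> with \<open>p\<close> inside and \<open>q\<close> outside.
  Both kinds of failure fill rectangles in \<open>P \<times> Q\<close>.  If a basis \<open>X\<close> attains the bounds of \<open>H\<^sub>i\<close> and \<open>H\<^sub>j\<close>, then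
  \<open>H\<^sub>i \<inter> H\<^sub>j \<subseteq> X \<subseteq> H\<^sub>i \<union> H\<^sub>j\<close> (\<open>base_two_tight\<close>), which makes rectangles of one kind disjoint in rows and
  in columns; and the target being a pair of bases bounds the half-perimeters by \<open>|P|\<close>.
  Such rectangles cover \<open>P \<times> Q\<close> only in a rigid way, with two rectangles of half the side length of
  each kind (\<open>covering_rectangles\<close>).

  An arbitrary possible exchange can lead to a dead end later, so an invariant is needed.  Four sets \<open>H\<^sub>1, \<dots>, H\<^sub>4\<close> form an
  obstruction if \<open>H\<^sub>1, H\<^sub>2\<close> are attained by \<open>Z \<union> P\<close> and \<open>Z \<union> Q\<close>, \<open>H\<^sub>3, H\<^sub>4\<close> are attained by \<open>W \<union> P\<close> and \<open>W \<union> Q\<close>,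
  and \<open>P\<close> and \<open>Q\<close> have different numbers of elements in \<open>H\<^sub>1 \<inter> H\<^sub>3\<close>.  Then each element of \<open>P \<union> Q\<close> lies in
  exactly one of \<open>H\<^sub>1, H\<^sub>2\<close> and exactly one of \<open>H\<^sub>3, H\<^sub>4\<close>, and only elements in the same cell can be exchanged, so the
  difference of the two numbers never vanishes and the target is unreachable.
  The rigid covering is an obstruction, so without an obstruction some exchange is possible.
  If it creates an obstruction, then replacing one of the two exchanged elements avoids all obstructions, unless
  the same obstruction was there before (\<open>exists_good_exchange\<close>).  Finally, disjoint bases start
  without an obstruction: both \<open>A\<close> and \<open>B\<close> attain the bounds of \<open>H\<^sub>1\<close> and \<open>H\<^sub>3\<close>, so the two numbers are equal
  if \<open>H\<^sub>1\<close> and \<open>H\<^sub>3\<close> are the same set of the system, and otherwise \<open>H\<^sub>1 \<inter> H\<^sub>3 \<subseteq> A \<inter> B = {}\<close> makes both zero.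
\<close>

section \<open>Orderings of two sets exchanged element by element\<close>

text \<open>
  The sets passed through on the way from \<open>B\<close> to \<open>A\<close> and on the way from \<open>A\<close> to \<open>B\<close> may satisfy different predicates.
  In the recursion, the two sides are completed by different sets \<open>W\<close> and \<open>Z\<close> of elements already exchanged.
\<close>

definition serial_exchange ::
    "('a set \<Rightarrow> bool) \<Rightarrow> ('a set \<Rightarrow> bool) \<Rightarrow> 'a set \<Rightarrow> 'a set \<Rightarrow> bool" where
  "serial_exchange F G A B \<longleftrightarrow>
    (\<exists>as bs. distinct as \<and> distinct bs \<and> set as = A \<and> set bs = B \<and> length as = length bs \<and>
      (\<forall>t\<le>length as. F (set (take t as) \<union> set (drop t bs)) \<and>
                      G (set (take t bs) \<union> set (drop t as))))"

text \<open>
  At each moment at most one of the two concatenated orderings is in progress, and the other one is at its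
  beginning or at its end, where it also satisfies its predicate.
\<close>

lemma serial_exchange_append:
  assumes 1: "serial_exchange F G A B" and 2: "serial_exchange F' G' A' B'"
    and disj: "A \<inter> A' = {}" "B \<inter> B' = {}"
    and F: "\<And>X Y. X \<subseteq> A \<union> B \<Longrightarrow> Y \<subseteq> A' \<union> B' \<Longrightarrow> F X \<Longrightarrow> F' Y \<Longrightarrow> F'' (X \<union> Y)"
    and G: "\<And>X Y. X \<subseteq> A \<union> B \<Longrightarrow> Y \<subseteq> A' \<union> B' \<Longrightarrow> G X \<Longrightarrow> G' Y \<Longrightarrow> G'' (X \<union> Y)"
  shows "serial_exchange F'' G'' (A \<union> A') (B \<union> B')"
proof -
  obtain as bs where l: "distinct as" "distinct bs" "set as = A" "set bs = B" "length as = length bs"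
    and FG: "\<And>t. t \<le> length as \<Longrightarrow> F (set (take t as) \<union> set (drop t bs))"
       "\<And>t. t \<le> length as \<Longrightarrow> G (set (take t bs) \<union> set (drop t as))"
    using 1 unfolding serial_exchange_def by blast
  obtain as' bs' where l': "distinct as'" "distinct bs'" "set as' = A'" "set bs' = B'"
      "length as' = length bs'"
    and FG': "\<And>t. t \<le> length as' \<Longrightarrow> F' (set (take t as') \<union> set (drop t bs'))"
       "\<And>t. t \<le> length as' \<Longrightarrow> G' (set (take t bs') \<union> set (drop t as'))"
    using 2 unfolding serial_exchange_def by blast
  have sub: "set (take t as) \<union> set (drop t bs) \<subseteq> A \<union> B" "set (take t bs) \<union> set (drop t as) \<subseteq> A \<union> B"
     "set (take t as') \<union> set (drop t bs') \<subseteq> A' \<union> B'" "set (take t bs') \<union> set (drop t as') \<subseteq> A' \<union> B'"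
    for t
    using set_take_subset[of t as] set_take_subset[of t bs] set_drop_subset[of t as]
      set_drop_subset[of t bs] set_take_subset[of t as'] set_take_subset[of t bs']
      set_drop_subset[of t as'] set_drop_subset[of t bs'] l l' by blast+
  have "F'' (set (take t (as @ as')) \<union> set (drop t (bs @ bs'))) \<and>
        G'' (set (take t (bs @ bs')) \<union> set (drop t (as @ as')))"
    if t: "t \<le> length (as @ as')" for t
  proof -
    define s where "s = min t (length as)"
    define u where "u = t - length as"
    have su: "s \<le> length as" "u \<le> length as'" using t by (auto simp: s_def u_def)
    have tk: "take t as = take s as" "take t bs = take s bs" "drop t as = drop s as"
        "drop t bs = drop s bs"
      using l(5) by (auto simp: s_def min_def)
    have "set (take t (as @ as')) \<union> set (drop t (bs @ bs')) =
        (set (take s as) \<union> set (drop s bs)) \<union> (set (take u as') \<union> set (drop u bs'))"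
      "set (take t (bs @ bs')) \<union> set (drop t (as @ as')) =
        (set (take s bs) \<union> set (drop s as)) \<union> (set (take u bs') \<union> set (drop u as'))"
      using l(5) by (auto simp: tk u_def)
    then show ?thesis using F[OF sub(1,3) FG(1)[OF su(1)] FG'(1)[OF su(2)]]
        G[OF sub(2,4) FG(2)[OF su(1)] FG'(2)[OF su(2)]] by simp
  qed
  moreover have "distinct (as @ as')" "distinct (bs @ bs')" using l l' disj by simp_all
  moreover have "set (as @ as') = A \<union> A'" "set (bs @ bs') = B \<union> B'"
      "length (as @ as') = length (bs @ bs')"
    using l l' by simp_all
  ultimately show ?thesis unfolding serial_exchange_def by blast
qed

lemma serial_exchange_refl:
  assumes "finite C" "F C" "G C"
  shows "serial_exchange F G C C"
proof -
  obtain cs where "set cs = C" "distinct cs" using finite_distinct_list[OF assms(1)] by blast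
  moreover have "set (take t cs) \<union> set (drop t cs) = set cs" for t
    by (metis append_take_drop_id set_append)
  ultimately show ?thesis unfolding serial_exchange_def using assms
    by (intro exI[of _ cs]) auto
qed

lemma serial_exchange_Cons:
  assumes "serial_exchange F' G' A' B'" "a \<notin> A'" "b \<notin> B'"
    and F: "\<And>X. F' X \<Longrightarrow> F (insert a X)" and G: "\<And>X. G' X \<Longrightarrow> G (insert b X)"
    and F0: "F (insert b B')" and G0: "G (insert a A')"
  shows "serial_exchange F G (insert a A') (insert b B')"
proof -
  obtain as bs where l: "distinct as" "distinct bs" "set as = A'" "set bs = B'" "length as = length bs"
    and FG: "\<And>t. t \<le> length as \<Longrightarrow> F' (set (take t as) \<union> set (drop t bs))"
       "\<And>t. t \<le> length as \<Longrightarrow> G' (set (take t bs) \<union> set (drop t as))"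
    using assms(1) unfolding serial_exchange_def by blast
  have "F (set (take t (a # as)) \<union> set (drop t (b # bs))) \<and>
        G (set (take t (b # bs)) \<union> set (drop t (a # as)))"
    if t: "t \<le> length (a # as)" for t
  proof (cases t)
    case 0
    then show ?thesis using F0 G0 l by simp
  next
    case (Suc s)
    then show ?thesis using F[OF FG(1)[of s]] G[OF FG(2)[of s]] t by simp
  qed
  then show ?thesis unfolding serial_exchange_def
    using l assms(2,3) by (intro exI[of _ "a # as"] exI[of _ "b # bs"]) auto
qed

section \<open>Coverings of a square by rectangles\<close>

lemma card_Int_swap:
  assumes "finite X" "p \<in> X" "q \<notin> X"
  shows "card (insert q (X - {p}) \<inter> T) + of_bool (p \<in> T) = card (X \<inter> T) + of_bool (q \<in> T)"
proof -
  have 1: "card ((X - {p}) \<inter> T) + of_bool (p \<in> T) = card (X \<inter> T)"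
  proof (cases "p \<in> T")
    case True
    then have "(X - {p}) \<inter> T = (X \<inter> T) - {p}" "p \<in> X \<inter> T" using assms by auto
    then show ?thesis using assms(1) True by (simp add: card_Suc_Diff1 del: card_Diff_insert)
  next
    case False
    then have "(X - {p}) \<inter> T = X \<inter> T" by auto
    then show ?thesis using False by simp
  qed
  have 2: "card (insert q (X - {p}) \<inter> T) = card ((X - {p}) \<inter> T) + of_bool (q \<in> T)"
    using assms by (auto simp: Int_insert_left)
  show ?thesis using 1 2 by simp
qed

lemma card_insert_Diff_swap:
  assumes "finite X" "p \<in> X" "q \<notin> X"
  shows "card (insert q (X - {p})) = card X"
  using assms by (metis DiffD1 card_Suc_Diff1 card_insert_disjoint finite_Diff)

lemma card_Un_Int_disjoint:
  assumes "finite Z" "finite P" "Z \<inter> P = {}"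
  shows "card ((Z \<union> P) \<inter> T) = card (Z \<inter> T) + card (P \<inter> T)"
proof -
  have "(Z \<union> P) \<inter> T = (Z \<inter> T) \<union> (P \<inter> T)" by auto
  then show ?thesis using assms by (auto intro: card_Un_disjoint)
qed

text \<open>
  The rectangles \<open>U k \<times> V k\<close> have half-perimeter at most \<open>M = |P| = |Q|\<close> and come in two classes, told apart by \<open>c\<close>;
  within a class they share neither rows nor columns.  As \<open>|U| |V| \<le> M (|U| + |V|) / 4\<close> and the
  side lengths in one class add up to at most \<open>2 M\<close>, each class covers at most half of the square.  A full
  covering thus forces equality throughout: two diagonal blocks of side \<open>M / 2\<close> in one class, and the two complementary
  blocks in the other.

  The proof replaces this counting by an extremal argument.  A row meeting a rectangle \<open>k\<close> of largest \<open>|U k|\<close> must be completed by one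
  rectangle \<open>l\<close> of the other class, and the size bounds then give \<open>U l = U k\<close> and \<open>|U k| \<le> M / 2\<close>; the
  same consideration for columns gives equality.
\<close>

lemma covering_rectangles:
  fixes U :: "'k \<Rightarrow> 'a set" and V :: "'k \<Rightarrow> 'b set" and c :: "'k \<Rightarrow> bool"
  assumes fin: "finite P" "finite Q" and eq: "card P = card Q" and ne: "P \<noteq> {}"
    and sub: "\<And>k. k \<in> K \<Longrightarrow> U k \<subseteq> P \<and> V k \<subseteq> Q"
    and size: "\<And>k. k \<in> K \<Longrightarrow> card (U k) + card (V k) \<le> card P"
    and disj: "\<And>k l. k \<in> K \<Longrightarrow> l \<in> K \<Longrightarrow> c k = c l \<Longrightarrow> k \<noteq> l \<Longrightarrow>
                  U k \<inter> U l = {} \<and> V k \<inter> V l = {}"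
    and cover: "\<And>p q. p \<in> P \<Longrightarrow> q \<in> Q \<Longrightarrow> \<exists>k\<in>K. p \<in> U k \<and> q \<in> V k"
  shows "\<exists>k1\<in>K. \<exists>k2\<in>K. \<exists>l1\<in>K. \<exists>l2\<in>K. c k1 \<and> c k2 \<and> \<not> c l1 \<and> \<not> c l2 \<and>
           U l1 = U k1 \<and> U k2 = P - U k1 \<and> U l2 = P - U k1 \<and>
           V l2 = V k1 \<and> V k2 = Q - V k1 \<and> V l1 = Q - V k1 \<and>
           2 * card (U k1) = card P \<and> 2 * card (V k1) = card P"
proof -
  define M where "M = card P"
  have finU: "finite (U k)" "finite (V k)" if "k \<in> K" for k
    using sub[OF that] fin finite_subset by auto
  have Mpos: "M > 0" using ne fin by (auto simp: M_def card_gt_0_iff)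
  have Qne: "Q \<noteq> {}" using ne eq fin by auto
  obtain p0 q0 where pq0: "p0 \<in> P" "q0 \<in> Q" using ne Qne by blast
  obtain k0 where k0: "k0 \<in> K" "p0 \<in> U k0" using cover[OF pq0] by blast
  have bnd: "\<forall>k. k \<in> K \<longrightarrow> card (U k) < Suc M"
    using sub fin by (auto simp: M_def less_Suc_eq_le intro: card_mono)
  obtain k where k: "k \<in> K" and kmax: "\<And>l. l \<in> K \<Longrightarrow> card (U l) \<le> card (U k)"
    using ex_has_greatest_nat[of "\<lambda>k. k \<in> K" k0 "\<lambda>k. card (U k)" "Suc M"] k0(1) bnd
    by (metis less_imp_le)
  have upos: "card (U k) > 0"
    using kmax[OF k0(1)] k0 finU[OF k0(1)] by (metis card_gt_0_iff empty_iff le_zero_eq neq0_conv)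
  have vlt: "card (V k) < M" using size[OF k] upos by (simp add: M_def)
  then obtain q1 where q1: "q1 \<in> Q" "q1 \<notin> V k"
    using sub[OF k] eq by (metis M_def nat_neq_iff subsetI subset_antisym)
  \<comment> \<open>rectangles of one class share no rows, so what \<open>k\<close> leaves uncovered in a row of \<open>U k\<close> falls to a single rectangle of the other class\<close>
  have other: "\<exists>l\<in>K. c l \<noteq> c k \<and> p \<in> U l \<and> Q - V k \<subseteq> V l" if p: "p \<in> U k" for p
  proof -
    have pP: "p \<in> P" using p sub[OF k] by auto
    have ex: "\<exists>l\<in>K. c l \<noteq> c k \<and> p \<in> U l \<and> q \<in> V l" if "q \<in> Q - V k" for q
      using cover[OF pP, of q] that disj[OF _ k] p by (metis DiffE disjoint_iff)
    obtain l where l: "l \<in> K" "c l \<noteq> c k" "p \<in> U l" using ex[of q1] q1 by auto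
    have "q \<in> V l" if q: "q \<in> Q - V k" for q
    proof -
      obtain l' where l': "l' \<in> K" "c l' \<noteq> c k" "p \<in> U l'" "q \<in> V l'" using ex[OF q] by auto
      have "l' = l" using disj[OF l'(1) l(1)] l l' by (metis disjoint_iff)
      then show ?thesis using l' by simp
    qed
    then show ?thesis using l by blast
  qed
  obtain p1 where p1: "p1 \<in> U k" using upos by (metis card_gt_0_iff ex_in_conv)
  obtain l where l: "l \<in> K" "c l \<noteq> c k" "Q - V k \<subseteq> V l" using other[OF p1] by auto
  have UkUl: "U k \<subseteq> U l"
  proof
    fix p assume p: "p \<in> U k"
    obtain l' where l': "l' \<in> K" "c l' \<noteq> c k" "p \<in> U l'" "Q - V k \<subseteq> V l'"
      using other[OF p] by auto
    have "q1 \<in> V l \<inter> V l'" using l l' q1 by auto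
    then have "l' = l" using disj[OF l'(1) l(1)] l l' by (metis empty_iff inf_commute)
    then show "p \<in> U l" using l' by simp
  qed
  have Ul: "U l = U k"
    using UkUl kmax[OF l(1)] finU[OF l(1)] card_seteq by metis
  have QV: "card (Q - V k) = M - card (V k)"
    using sub[OF k] finU[OF k] eq by (simp add: card_Diff_subset M_def)
  have vl: "M - card (V k) \<le> card (V l)"
    using card_mono[OF finU(2)[OF l(1)] l(3)] QV by simp
  have half: "2 * card (U k) \<le> M"
    using size[OF k] size[OF l(1)] vl Ul vlt by (simp add: M_def)
  have Vkne: "V k \<noteq> {}"
    using size[OF l(1)] vl Ul upos by (auto simp: M_def)
  \<comment> \<open>the same for columns; the bound on \<open>U j\<close> ensures that \<open>j\<close> does not fill its columns alone\<close>
  have col: "\<exists>l'\<in>K. c l' \<noteq> c j \<and> q \<in> V l' \<and> P - U j \<subseteq> U l'"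
    if j: "j \<in> K" "q \<in> V j" "2 * card (U j) \<le> M" for j q
  proof -
    have qQ: "q \<in> Q" using j sub[OF j(1)] by auto
    have "card (U j) < M" using j(3) Mpos by linarith
    then obtain p2 where p2: "p2 \<in> P" "p2 \<notin> U j"
      using sub[OF j(1)] by (metis M_def nat_neq_iff subsetI subset_antisym)
    have ex: "\<exists>l\<in>K. c l \<noteq> c j \<and> p \<in> U l \<and> q \<in> V l" if "p \<in> P - U j" for p
      using cover[OF _ qQ, of p] that disj[OF _ j(1)] j(2) by (metis DiffE disjoint_iff)
    obtain l where l: "l \<in> K" "c l \<noteq> c j" "q \<in> V l" using ex[of p2] p2 by auto
    have "p \<in> U l" if p: "p \<in> P - U j" for p
    proof -
      obtain l' where l': "l' \<in> K" "c l' \<noteq> c j" "p \<in> U l'" "q \<in> V l'" using ex[OF p] by auto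
      have "l' = l" using disj[OF l'(1) l(1)] l l' by (metis disjoint_iff)
      then show ?thesis using l' by simp
    qed
    then show ?thesis using l by blast
  qed
  have PU: "card (P - U j) = M - card (U j)" if "j \<in> K" for j
    using sub[OF that] finU[OF that] by (simp add: card_Diff_subset M_def)
  have uM: "2 * card (U k) = M"
  proof -
    obtain q where q: "q \<in> V k" using Vkne by auto
    obtain l' where l': "l' \<in> K" "P - U k \<subseteq> U l'" using col[OF k q half] by auto
    have "M - card (U k) \<le> card (U l')"
      using card_mono[OF finU(1)[OF l'(1)] l'(2)] PU[OF k] by simp
    then show ?thesis using kmax[OF l'(1)] half by linarith
  qed
  have vM: "2 * card (V k) = M" "2 * card (V l) = M"
    using size[OF k] size[OF l(1)] vl Ul uM vlt by (auto simp: M_def)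
  have Vl: "V l = Q - V k"
    using l(3) QV vM finU(2)[OF l(1)] card_seteq[of "V l" "Q - V k"] by simp
  have "card (U k) < M" using uM Mpos by linarith
  then obtain p2 where p2: "p2 \<in> P" "p2 \<notin> U k"
    using sub[OF k] by (metis M_def nat_neq_iff subsetI subset_antisym)
  \<comment> \<open>the row \<open>p2\<close> meets neither \<open>k\<close> nor \<open>l\<close>, which yields the remaining two blocks\<close>
  have row2: "\<exists>j\<in>K. p2 \<in> U j \<and> q \<in> V j \<and> j \<noteq> k \<and> j \<noteq> l" if "q \<in> Q" for q
    using cover[OF p2(1) that] p2 Ul by metis
  obtain qk where qk: "qk \<in> V k" using Vkne by auto
  have qkQ: "qk \<in> Q" "qk \<notin> V l" using qk sub[OF k] Vl by auto
  have ql: "q1 \<in> V l" using q1 Vl by auto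
  obtain k' where k': "k' \<in> K" "p2 \<in> U k'" "q1 \<in> V k'" "k' \<noteq> k" "k' \<noteq> l"
    using row2[OF q1(1)] by auto
  obtain l' where l': "l' \<in> K" "p2 \<in> U l'" "qk \<in> V l'" "l' \<noteq> k" "l' \<noteq> l"
    using row2[OF qkQ(1)] by auto
  have ck': "c k' = c k" using disj[OF k'(1) l(1)] k' ql l(2) by blast
  have cl': "c l' = c l" using disj[OF l'(1) k] l' qk l(2) by blast
  have Vk': "V k' = Q - V k"
  proof
    show "V k' \<subseteq> Q - V k" using disj[OF k'(1) k ck' k'(4)] sub[OF k'(1)] by blast
    show "Q - V k \<subseteq> V k'"
    proof
      fix q assume q: "q \<in> Q - V k"
      then obtain j where j: "j \<in> K" "p2 \<in> U j" "q \<in> V j" "j \<noteq> l" using row2[of q] by auto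
      have "c j \<noteq> c l" using disj[OF j(1) l(1)] j q Vl by blast
      then have "c j = c k'" using ck' l(2) by blast
      then have "j = k'" using disj[OF j(1) k'(1)] j k' by blast
      then show "q \<in> V k'" using j by simp
    qed
  qed
  have Vl': "V l' = V k"
  proof
    show "V l' \<subseteq> V k" using disj[OF l'(1) l(1) cl' l'(5)] sub[OF l'(1)] Vl by blast
    show "V k \<subseteq> V l'"
    proof
      fix q assume q: "q \<in> V k"
      then obtain j where j: "j \<in> K" "p2 \<in> U j" "q \<in> V j" "j \<noteq> k"
        using row2[of q] sub[OF k] by auto
      have "c j \<noteq> c k" using disj[OF j(1) k] j q by blast
      then have "c j = c l'" using cl' l(2) by blast
      then have "j = l'" using disj[OF j(1) l'(1)] j l' by blast
      then show "q \<in> V l'" using j by simp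
    qed
  qed
  have Uk': "U k' = P - U k"
  proof
    show "U k' \<subseteq> P - U k" using disj[OF k'(1) k ck' k'(4)] sub[OF k'(1)] by blast
    have "2 * card (U l) \<le> M" using Ul uM by simp
    then obtain j where j: "j \<in> K" "c j \<noteq> c l" "q1 \<in> V j" "P - U l \<subseteq> U j"
      using col[OF l(1) ql] by auto
    have "j = k'" using disj[OF j(1) k'(1)] j k' ck' l(2) by blast
    then show "P - U k \<subseteq> U k'" using j Ul by simp
  qed
  have Ul': "U l' = P - U k"
  proof
    show "U l' \<subseteq> P - U k" using disj[OF l'(1) l(1) cl' l'(5)] sub[OF l'(1)] Ul by blast
    obtain j where j: "j \<in> K" "c j \<noteq> c k" "qk \<in> V j" "P - U k \<subseteq> U j"
      using col[OF k qk half] by auto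
    have "j = l'" using disj[OF j(1) l'(1)] j l' cl' l(2) by blast
    then show "P - U k \<subseteq> U l'" using j by simp
  qed
  show ?thesis
  proof (cases "c k")
    case True
    then have cc: "c k" "c k'" "\<not> c l" "\<not> c l'" using l(2) ck' cl' by auto
    have "2 * card (U k) = card P" "2 * card (V k) = card P" using uM vM by (auto simp: M_def)
    note cc = cc this
    show ?thesis
      by (intro bexI[of _ k] bexI[of _ k'] bexI[of _ l] bexI[of _ l'] conjI)
        (fact cc Ul Uk' Ul' Vl Vk' Vl' k l(1) k'(1) l'(1))+
  next
    case False
    then have cc: "c l" "c l'" "\<not> c k" "\<not> c k'" using l(2) ck' cl' by auto
    have VV: "V k = Q - V l" "V k' = V l" "V l' = Q - V l" using Vl Vk' Vl' sub[OF k] by auto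
    have UU: "U k = U l" "U l' = P - U l" "U k' = P - U l" using Ul Uk' Ul' by auto
    have "2 * card (U l) = card P" "2 * card (V l) = card P" using uM vM Ul by (auto simp: M_def)
    note cc = cc this
    show ?thesis
      by (intro bexI[of _ l] bexI[of _ l'] bexI[of _ k] bexI[of _ k'] conjI)
        (fact cc VV UU k l(1) k'(1) l'(1))+
  qed
qed

section \<open>Symmetric exchanges under cardinality bounds\<close>

text \<open>
  The conditions on the sets \<open>H\<^sub>i\<close> that the exchange argument uses.  They are preserved by contraction and
  do not mention a ground set.
\<close>

locale split_system =
  fixes J :: "'i set" and H :: "'i \<Rightarrow> 'a set" and \<rho> :: "'i \<Rightarrow> nat" and r :: nat
  assumes finite_H: "i \<in> J \<Longrightarrow> finite (H i)"
    and cross: "i \<in> J \<Longrightarrow> j \<in> J \<Longrightarrow> i \<noteq> j \<Longrightarrow> card (H i \<inter> H j) + r \<le> \<rho> i + \<rho> j"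
begin

definition base :: "'a set \<Rightarrow> bool" where
  "base X \<longleftrightarrow> finite X \<and> card X = r \<and> (\<forall>i\<in>J. card (X \<inter> H i) \<le> \<rho> i)"

definition tight :: "'i \<Rightarrow> 'a set \<Rightarrow> bool" where
  "tight i X \<longleftrightarrow> i \<in> J \<and> card (X \<inter> H i) = \<rho> i"

text \<open>
  \<open>|X \<inter> H\<^sub>i| + |X \<inter> H\<^sub>j| = |X \<inter> (H\<^sub>i \<union> H\<^sub>j)| + |X \<inter> H\<^sub>i \<inter> H\<^sub>j| \<le> r + |H\<^sub>i \<inter> H\<^sub>j|\<close>, and the left-hand side is
  \<open>\<rho>\<^sub>i + \<rho>\<^sub>j\<close>, which is at least the right-hand side.  So both estimates are equalities.
\<close>

lemma two_tight:
  assumes X: "finite X" "card X \<le> r" and "tight i X" "tight j X" "i \<noteq> j"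
  shows "X \<subseteq> H i \<union> H j" "H i \<inter> H j \<subseteq> X" "card X = r"
proof -
  have ij: "i \<in> J" "j \<in> J" and c: "card (X \<inter> H i) = \<rho> i" "card (X \<inter> H j) = \<rho> j"
    using assms by (auto simp: tight_def)
  have fin: "finite (H i)" "finite (H j)" using ij finite_H by auto
  have "card (X \<inter> H i) + card (X \<inter> H j) = card (X \<inter> (H i \<union> H j)) + card (X \<inter> (H i \<inter> H j))"
    using card_Un_Int[of "X \<inter> H i" "X \<inter> H j"] X(1)
    by (simp add: Int_Un_distrib Int_assoc Int_left_commute)
  moreover have "card (X \<inter> (H i \<union> H j)) \<le> card X" "card (X \<inter> (H i \<inter> H j)) \<le> card (H i \<inter> H j)"
    using X fin by (auto intro: card_mono)
  moreover have "card (H i \<inter> H j) + r \<le> \<rho> i + \<rho> j" using cross ij assms by auto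
  ultimately have e: "card (X \<inter> (H i \<union> H j)) = card X" "card X = r"
      "card (X \<inter> (H i \<inter> H j)) = card (H i \<inter> H j)"
    using c X(2) by linarith+
  show "card X = r" by fact
  have "X \<inter> (H i \<union> H j) = X" using e(1) X by (intro card_subset_eq) auto
  then show "X \<subseteq> H i \<union> H j" by auto
  have "X \<inter> (H i \<inter> H j) = H i \<inter> H j" using e(3) fin by (intro card_subset_eq) auto
  then show "H i \<inter> H j \<subseteq> X" by auto
qed

lemma base_two_tight:
  assumes "base X" "tight i X" "tight j X" "i \<noteq> j"
  shows "X \<subseteq> H i \<union> H j" "H i \<inter> H j \<subseteq> X"
  using two_tight[of X i j] assms by (auto simp: base_def)

lemma base_swap:
  assumes "base X" "p \<in> X" "q \<notin> X" "\<And>i. tight i X \<Longrightarrow> q \<in> H i \<Longrightarrow> p \<in> H i"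
  shows "base (insert q (X - {p}))"
proof -
  have fin: "finite X" using assms by (auto simp: base_def)
  have "card (insert q (X - {p}) \<inter> H i) \<le> \<rho> i" if "i \<in> J" for i
  proof -
    have "card (X \<inter> H i) \<le> \<rho> i" using assms(1) that by (auto simp: base_def)
    moreover have "p \<in> H i \<or> card (X \<inter> H i) \<noteq> \<rho> i" if "q \<in> H i"
      using assms(4)[of i] that \<open>i \<in> J\<close> by (auto simp: tight_def)
    ultimately show ?thesis
      using card_Int_swap[OF fin assms(2,3), of "H i"]
      by (cases "p \<in> H i"; cases "q \<in> H i") (simp_all del: Int_insert_left_if0 Int_insert_left_if1)
  qed
  then show ?thesis using assms fin card_insert_Diff_swap[OF fin assms(2,3)]
    by (auto simp: base_def)
qed

lemma tight_swap_mem: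
  assumes "base (insert q (X - {p}))" "finite X" "p \<in> X" "q \<notin> X" "tight i X" "q \<in> H i"
  shows "p \<in> H i"
proof (rule ccontr)
  assume "p \<notin> H i"
  then have "card (insert q (X - {p}) \<inter> H i) = Suc (\<rho> i)"
    using card_Int_swap[OF assms(2-4), of "H i"] assms(5,6)
    by (simp add: tight_def del: Int_insert_left_if0 Int_insert_left_if1)
  moreover have "card (insert q (X - {p}) \<inter> H i) \<le> \<rho> i"
    using assms(1,5) unfolding base_def tight_def by blast
  ultimately show False by simp
qed

lemma tight_swap_iff:
  assumes "finite X" "p \<in> X" "q \<notin> X" "tight i X"
  shows "tight i (insert q (X - {p})) \<longleftrightarrow> (p \<in> H i \<longleftrightarrow> q \<in> H i)"
  using card_Int_swap[OF assms(1-3), of "H i"] assms(4)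
  by (cases "p \<in> H i"; cases "q \<in> H i")
    (simp_all add: tight_def del: Int_insert_left_if0 Int_insert_left_if1)

text \<open>
  The current pair is \<open>(Z \<union> P, W \<union> Q)\<close> and the target is \<open>(Z \<union> Q, W \<union> P)\<close>: the elements of \<open>P\<close> and \<open>Q\<close> are
  still to be exchanged, those of \<open>Z\<close> and \<open>W\<close> are in place.
\<close>

definition state :: "'a set \<Rightarrow> 'a set \<Rightarrow> 'a set \<Rightarrow> 'a set \<Rightarrow> bool" where
  "state Z W P Q \<longleftrightarrow>
    Z \<inter> W = {} \<and> Z \<inter> P = {} \<and> Z \<inter> Q = {} \<and> W \<inter> P = {} \<and> W \<inter> Q = {} \<and> P \<inter> Q = {} \<and>
    base (Z \<union> P) \<and> base (Z \<union> Q) \<and> base (W \<union> P) \<and> base (W \<union> Q)"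

text \<open>
  Since \<open>P\<close> and \<open>Q\<close> agree in their numbers of elements in \<open>H\<^sub>1\<close> and in \<open>H\<^sub>3\<close>, the last condition means that the
  \<open>2 \<times> 2\<close> tables of cell sizes of \<open>P\<close> and of \<open>Q\<close> have the same margins but different entries.
\<close>

definition obstruction ::
    "'i \<Rightarrow> 'i \<Rightarrow> 'i \<Rightarrow> 'i \<Rightarrow> 'a set \<Rightarrow> 'a set \<Rightarrow> 'a set \<Rightarrow> 'a set \<Rightarrow> bool" where
  "obstruction h1 h2 h3 h4 Z W P Q \<longleftrightarrow> h1 \<noteq> h2 \<and> h3 \<noteq> h4 \<and>
    tight h1 (Z \<union> P) \<and> tight h2 (Z \<union> P) \<and> tight h1 (Z \<union> Q) \<and> tight h2 (Z \<union> Q) \<and>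
    tight h3 (W \<union> P) \<and> tight h4 (W \<union> P) \<and> tight h3 (W \<union> Q) \<and> tight h4 (W \<union> Q) \<and>
    card (P \<inter> H h1 \<inter> H h3) \<noteq> card (Q \<inter> H h1 \<inter> H h3)"

definition obstructed :: "'a set \<Rightarrow> 'a set \<Rightarrow> 'a set \<Rightarrow> 'a set \<Rightarrow> bool" where
  "obstructed Z W P Q \<longleftrightarrow> (\<exists>h1 h2 h3 h4. obstruction h1 h2 h3 h4 Z W P Q)"

lemma state_swap: "state Z W P Q \<Longrightarrow> state W Z Q P"
  unfolding state_def by (simp add: Int_commute)

lemma obstruction_swap:
  assumes "obstruction h1 h2 h3 h4 Z W P Q"
  shows "obstruction h3 h4 h1 h2 W Z Q P"
proof -
  have "X \<inter> H h3 \<inter> H h1 = X \<inter> H h1 \<inter> H h3" for X by auto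
  then show ?thesis using assms unfolding obstruction_def by simp
qed

lemma obstructed_swap: "obstructed W Z Q P \<longleftrightarrow> obstructed Z W P Q"
  unfolding obstructed_def using obstruction_swap by blast

lemma state_finite:
  assumes "state Z W P Q"
  shows "finite Z" "finite W" "finite P" "finite Q"
  using assms by (auto simp: state_def base_def)

lemma state_card:
  assumes "state Z W P Q"
  shows "card P = card Q"
proof -
  have "card (Z \<union> P) = card Z + card P" "card (Z \<union> Q) = card Z + card Q"
    using assms state_finite[OF assms] by (auto simp: state_def intro: card_Un_disjoint)
  moreover have "card (Z \<union> P) = r" "card (Z \<union> Q) = r" using assms by (auto simp: state_def base_def)
  ultimately show ?thesis by simp
qed

lemma tight_margin:
  assumes "tight i (Z \<union> P)" "tight i (Z \<union> Q)" "finite Z" "finite P" "finite Q" "Z \<inter> P = {}" "Z \<inter> Q = {}"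
  shows "card (P \<inter> H i) = card (Q \<inter> H i)"
  using assms card_Un_Int_disjoint[of Z P "H i"] card_Un_Int_disjoint[of Z Q "H i"]
  by (simp add: tight_def)

lemma obstruction_cells:
  assumes st: "state Z W P Q" and ob: "obstruction h1 h2 h3 h4 Z W P Q"
  shows "\<And>e. e \<in> P \<union> Q \<Longrightarrow> e \<in> H h1 \<longleftrightarrow> e \<notin> H h2"
    "\<And>e. e \<in> P \<union> Q \<Longrightarrow> e \<in> H h3 \<longleftrightarrow> e \<notin> H h4"
    "Z \<subseteq> H h1 \<union> H h2" "W \<subseteq> H h3 \<union> H h4" "W \<inter> H h1 \<inter> H h2 = {}" "Z \<inter> H h3 \<inter> H h4 = {}"
proof -
  have t: "base (Z \<union> P)" "base (Z \<union> Q)" "base (W \<union> P)" "base (W \<union> Q)" using st by (auto simp: state_def)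
  have h12: "Z \<union> P \<subseteq> H h1 \<union> H h2" "H h1 \<inter> H h2 \<subseteq> Z \<union> P" "Z \<union> Q \<subseteq> H h1 \<union> H h2" "H h1 \<inter> H h2 \<subseteq> Z \<union> Q"
    using base_two_tight[OF t(1), of h1 h2] base_two_tight[OF t(2), of h1 h2] ob
    by (auto simp: obstruction_def)
  have h34: "W \<union> P \<subseteq> H h3 \<union> H h4" "H h3 \<inter> H h4 \<subseteq> W \<union> P" "W \<union> Q \<subseteq> H h3 \<union> H h4" "H h3 \<inter> H h4 \<subseteq> W \<union> Q"
    using base_two_tight[OF t(3), of h3 h4] base_two_tight[OF t(4), of h3 h4] ob
    by (auto simp: obstruction_def)
  have d: "Z \<inter> W = {}" "Z \<inter> P = {}" "Z \<inter> Q = {}" "W \<inter> P = {}" "W \<inter> Q = {}" "P \<inter> Q = {}"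
    using st by (auto simp: state_def)
  show "e \<in> H h1 \<longleftrightarrow> e \<notin> H h2" if e: "e \<in> P \<union> Q" for e
  proof (cases "e \<in> P")
    case True
    then have "e \<notin> Z \<union> Q" "e \<in> Z \<union> P" using d by auto
    then show ?thesis using subsetD[OF h12(1), of e] subsetD[OF h12(4), of e] by auto
  next
    case False
    then have "e \<notin> Z \<union> P" "e \<in> Z \<union> Q" using d e by auto
    then show ?thesis using subsetD[OF h12(3), of e] subsetD[OF h12(2), of e] by auto
  qed
  show "e \<in> H h3 \<longleftrightarrow> e \<notin> H h4" if e: "e \<in> P \<union> Q" for e
  proof (cases "e \<in> P")
    case True
    then have "e \<notin> W \<union> Q" "e \<in> W \<union> P" using d by auto
    then show ?thesis using subsetD[OF h34(1), of e] subsetD[OF h34(4), of e] by auto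
  next
    case False
    then have "e \<notin> W \<union> P" "e \<in> W \<union> Q" using d e by auto
    then show ?thesis using subsetD[OF h34(3), of e] subsetD[OF h34(2), of e] by auto
  qed
  show "Z \<subseteq> H h1 \<union> H h2" using h12(1) by simp
  show "W \<subseteq> H h3 \<union> H h4" using h34(1) by simp
  have "W \<inter> (Z \<union> P) = {}" using d by auto
  then show "W \<inter> H h1 \<inter> H h2 = {}" using h12(2) by auto
  have "Z \<inter> (W \<union> P) = {}" using d by auto
  then show "Z \<inter> H h3 \<inter> H h4 = {}" using h34(2) by auto
qed

text \<open>
  If \<open>P\<close> misses one of the four sets, then so does \<open>Q\<close>, by the equal margins; a row or column of both tables
  is then zero and the margins determine all entries, so the tables agree.
\<close>

lemma obstruction_meets:
  assumes st: "state Z W P Q" and ob: "obstruction h1 h2 h3 h4 Z W P Q"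
    and h: "h \<in> {h1, h2, h3, h4}"
  shows "P \<inter> H h \<noteq> {}" "Q \<inter> H h \<noteq> {}"
proof -
  note fin = state_finite[OF st]
  have d: "Z \<inter> P = {}" "Z \<inter> Q = {}" "W \<inter> P = {}" "W \<inter> Q = {}" using st by (auto simp: state_def)
  have m: "card (P \<inter> H g) = card (Q \<inter> H g)" if "g \<in> {h1, h2, h3, h4}" for g
    using that ob tight_margin[of g Z P Q] tight_margin[of g W P Q] fin d
    by (auto simp: obstruction_def)
  have ne: "card (P \<inter> H h1 \<inter> H h3) \<noteq> card (Q \<inter> H h1 \<inter> H h3)" using ob by (auto simp: obstruction_def)
  note cells = obstruction_cells[OF st ob]
  have "\<not> (P \<inter> H h = {} \<and> Q \<inter> H h = {})"
  proof
    assume e: "P \<inter> H h = {} \<and> Q \<inter> H h = {}"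
    consider "h = h1 \<or> h = h3" | "h = h2" | "h = h4" using h by auto
    then show False
    proof cases
      case 1
      then have "P \<inter> H h1 \<inter> H h3 = {}" "Q \<inter> H h1 \<inter> H h3 = {}" using e by auto
      then show ?thesis using ne by simp
    next
      case 2
      then have "P \<inter> H h1 \<inter> H h3 = P \<inter> H h3" "Q \<inter> H h1 \<inter> H h3 = Q \<inter> H h3" using e cells(1) by auto
      then show ?thesis using ne m by simp
    next
      case 3
      then have "P \<inter> H h1 \<inter> H h3 = P \<inter> H h1" "Q \<inter> H h1 \<inter> H h3 = Q \<inter> H h1" using e cells(2) by auto
      then show ?thesis using ne m by simp
    qed
  qed
  moreover have "P \<inter> H h = {} \<longleftrightarrow> Q \<inter> H h = {}" using m[OF h] fin by (metis card_0_eq finite_Int)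
  ultimately show "P \<inter> H h \<noteq> {}" "Q \<inter> H h \<noteq> {}" by auto
qed

text \<open>
  With \<open>Z\<close>, \<open>Q\<close> and \<open>W \<union> P\<close> kept, all sets involved are attained by the same bases \<open>Z \<union> Q\<close> and \<open>W \<union> P\<close>.  The set \<open>Q\<close> is
  split between the complements of \<open>H\<^sub>1\<close> and \<open>H\<^sub>2\<close>, so any further set attained by \<open>Z \<union> Q\<close> contains \<open>Q\<close>; and it is split
  between \<open>H\<^sub>3\<close> and \<open>H\<^sub>4\<close>, so any further set attained by \<open>W \<union> P\<close> is disjoint from \<open>Q\<close>.  Neither is possible for a member
  of an obstruction.
\<close>

lemma obstruction_unique:
  assumes st: "state Z W P Q" and ob: "obstruction h1 h2 h3 h4 Z W P Q"
    and st': "state Z W' P' Q" and ob': "obstruction k1 k2 k3 k4 Z W' P' Q"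
    and W: "W' \<union> P' = W \<union> P"
  shows "{k1, k2} = {h1, h2} \<and> {k3, k4} = {h3, h4}"
proof -
  note cells = obstruction_cells[OF st ob]
  note cells' = obstruction_cells[OF st' ob']
  note meets = obstruction_meets(2)[OF st' ob']
  have b: "base (Z \<union> Q)" "base (W \<union> P)" using st by (auto simp: state_def)
  have d: "W \<inter> Q = {}" "P \<inter> Q = {}" using st by (auto simp: state_def)
  have 1: "k \<in> {h1, h2}" if k: "k \<in> {k1, k2}" for k
  proof (rule ccontr)
    assume n: "k \<notin> {h1, h2}"
    have t: "tight k (Z \<union> Q)" "tight h1 (Z \<union> Q)" "tight h2 (Z \<union> Q)"
      using ob ob' k by (auto simp: obstruction_def)
    have "k \<noteq> h1" "k \<noteq> h2" using n by auto
    then have "Z \<union> Q \<subseteq> H k \<union> H h1" "Z \<union> Q \<subseteq> H k \<union> H h2"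
      using base_two_tight(1)[OF b(1) t(1,2)] base_two_tight(1)[OF b(1) t(1,3)] by auto
    then have "e \<in> H k" if "e \<in> Q" for e using cells(1)[of e] that by auto
    then have "Q \<inter> H k1 = {} \<or> Q \<inter> H k2 = {}" using cells'(1) k by auto
    then show False using meets[of k1] meets[of k2] by auto
  qed
  have 2: "k \<in> {h3, h4}" if k: "k \<in> {k3, k4}" for k
  proof (rule ccontr)
    assume n: "k \<notin> {h3, h4}"
    have t: "tight k (W \<union> P)" "tight h3 (W \<union> P)" "tight h4 (W \<union> P)"
      using ob ob' k W by (auto simp: obstruction_def)
    have "k \<noteq> h3" "k \<noteq> h4" using n by auto
    then have "H k \<inter> H h3 \<subseteq> W \<union> P" "H k \<inter> H h4 \<subseteq> W \<union> P"
      using base_two_tight(2)[OF b(2) t(1,2)] base_two_tight(2)[OF b(2) t(1,3)] by auto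
    then have "e \<notin> H k" if "e \<in> Q" for e using cells(2)[of e] that d by auto
    then show False using meets[of k] k by auto
  qed
  have "k1 \<noteq> k2" "k3 \<noteq> k4" using ob' by (auto simp: obstruction_def)
  then show ?thesis using 1[of k1] 1[of k2] 2[of k3] 2[of k4] by auto
qed

text \<open>
  Here \<open>w\<close> is an element exchanged earlier: the step that moved \<open>w\<close> is revised to move \<open>p\<close> in its place.
\<close>

lemma state_exchange_W:
  assumes st: "state Z W P Q" and w: "w \<in> W" and p: "p \<in> P"
    and ZP: "\<And>i. tight i (Z \<union> P) \<Longrightarrow> w \<in> H i \<Longrightarrow> p \<in> H i"
    and WQ: "\<And>i. tight i (W \<union> Q) \<Longrightarrow> p \<in> H i \<Longrightarrow> w \<in> H i"
  shows "state Z (insert p (W - {w})) (insert w (P - {p})) Q"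
proof -
  have s: "Z \<inter> W = {}" "Z \<inter> P = {}" "Z \<inter> Q = {}" "W \<inter> P = {}" "W \<inter> Q = {}" "P \<inter> Q = {}"
    "base (Z \<union> P)" "base (Z \<union> Q)" "base (W \<union> P)" "base (W \<union> Q)"
    using st by (auto simp: state_def)
  have "base (insert w ((Z \<union> P) - {p}))"
    by (rule base_swap[OF s(7)]) (use s(1-6) w p ZP in auto)
  moreover have "insert w ((Z \<union> P) - {p}) = Z \<union> insert w (P - {p})" using s(2) p by auto
  ultimately have 1: "base (Z \<union> insert w (P - {p}))" by (simp only:)
  have "base (insert p ((W \<union> Q) - {w}))"
    by (rule base_swap[OF s(10)]) (use s(1-6) w p WQ in auto)
  moreover have "insert p ((W \<union> Q) - {w}) = insert p (W - {w}) \<union> Q" using s(5) w by auto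
  ultimately have 2: "base (insert p (W - {w}) \<union> Q)" by (simp only:)
  have "insert p (W - {w}) \<union> insert w (P - {p}) = W \<union> P" using w p by auto
  then have 3: "base (insert p (W - {w}) \<union> insert w (P - {p}))" using s(9) by (simp only:)
  show ?thesis unfolding state_def
    by (intro conjI 1 2 3 s(8)) (use s(1-6) w p in auto)
qed

text \<open>
  The element \<open>w\<close> lies in at most one of \<open>H\<^sub>1, H\<^sub>2\<close> and in at least one of \<open>H\<^sub>3, H\<^sub>4\<close>.  If it is not in exactly one of each, then
  there is room for a suitable \<open>p\<close> to replace it.  After the replacement, \<open>w\<close> is still to be exchanged, so an
  obstruction, which must consist of the same four sets, would place \<open>w\<close> in exactly one of each.
\<close>

lemma avoid_obstruction:
  assumes st: "state Z W P Q" and ob: "obstruction h1 h2 h3 h4 Z W P Q" and w: "w \<in> W"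
    and inexact: "w \<notin> H h1 \<union> H h2 \<or> w \<in> H h3 \<inter> H h4"
  shows "\<exists>p\<in>P. state Z (insert p (W - {w})) (insert w (P - {p})) Q \<and>
               \<not> obstructed Z (insert p (W - {w})) (insert w (P - {p})) Q"
proof -
  note cells = obstruction_cells[OF st ob]
  note meets = obstruction_meets(1)[OF st ob]
  have d: "Z \<inter> W = {}" "Z \<inter> P = {}" "Z \<inter> Q = {}" "W \<inter> P = {}" "W \<inter> Q = {}" "P \<inter> Q = {}"
    and b: "base (Z \<union> P)" "base (W \<union> Q)"
    using st by (auto simp: state_def)
  have t: "tight h1 (Z \<union> P)" "tight h2 (Z \<union> P)" "tight h3 (W \<union> Q)" "tight h4 (W \<union> Q)"
    using ob by (auto simp: obstruction_def)
  obtain p where p: "p \<in> P" "w \<in> H h1 \<Longrightarrow> p \<in> H h1" "w \<in> H h2 \<Longrightarrow> p \<in> H h2"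
      "p \<in> H h3 \<Longrightarrow> w \<in> H h3" "p \<in> H h4 \<Longrightarrow> w \<in> H h4"
  proof (cases "w \<in> H h1 \<union> H h2")
    case True
    then have "w \<in> H h3 \<inter> H h4" using inexact by simp
    then obtain h where h: "h \<in> {h1, h2}" "w \<in> H h" "w \<in> H h1 \<Longrightarrow> h = h1" "w \<in> H h2 \<Longrightarrow> h = h2"
      using True cells(5) w by blast
    obtain p where "p \<in> P" "p \<in> H h" using meets[of h] h(1) by auto
    then show ?thesis using that[of p] h(3,4) \<open>w \<in> H h3 \<inter> H h4\<close> by auto
  next
    case False
    obtain h where h: "h \<in> {h3, h4}" "w \<in> H h" using cells(4) w by auto
    obtain p where p: "p \<in> P" "p \<in> H h" using meets[of h] h(1) by auto
    then show ?thesis using that[of p] h False cells(2)[of p] by auto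
  qed
  let ?W = "insert p (W - {w})" and ?P = "insert w (P - {p})"
  have st': "state Z ?W ?P Q"
  proof (rule state_exchange_W[OF st w p(1)])
    fix i assume i: "tight i (Z \<union> P)" "w \<in> H i"
    show "p \<in> H i"
    proof (cases "i = h1 \<or> i = h2")
      case False
      then have "Z \<union> P \<subseteq> H i \<union> H h1" "Z \<union> P \<subseteq> H i \<union> H h2"
        using base_two_tight(1)[OF b(1) i(1) t(1)] base_two_tight(1)[OF b(1) i(1) t(2)] by auto
      then show ?thesis using cells(1)[of p] p(1) by auto
    qed (use p i in auto)
  next
    fix i assume i: "tight i (W \<union> Q)" "p \<in> H i"
    show "w \<in> H i"
    proof (cases "i = h3 \<or> i = h4")
      case False
      then have "H i \<inter> H h3 \<subseteq> W \<union> Q" "H i \<inter> H h4 \<subseteq> W \<union> Q"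
        using base_two_tight(2)[OF b(2) i(1) t(3)] base_two_tight(2)[OF b(2) i(1) t(4)] by auto
      then show ?thesis using cells(2)[of p] p(1) i(2) d by auto
    qed (use p i in auto)
  qed
  moreover have "\<not> obstructed Z ?W ?P Q"
  proof
    assume "obstructed Z ?W ?P Q"
    then obtain k1 k2 k3 k4 where ob': "obstruction k1 k2 k3 k4 Z ?W ?P Q"
      by (auto simp: obstructed_def)
    have "?W \<union> ?P = W \<union> P" using w p by auto
    then have "{k1, k2} = {h1, h2} \<and> {k3, k4} = {h3, h4}"
      using obstruction_unique[OF st ob st' ob'] by blast
    then have "(w \<in> H h1) = (w \<notin> H h2)" "(w \<in> H h3) = (w \<notin> H h4)"
      using obstruction_cells(1,2)[OF st' ob', of w] by (auto simp: doubleton_eq_iff)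
    then show False using inexact by auto
  qed
  ultimately show ?thesis using p(1) by blast
qed

text \<open>
  If every exchange were blocked, the blocking rectangles would cover \<open>P \<times> Q\<close>.  The only way to do so, by two
  blocks of each kind, is itself an obstruction: with \<open>P\<^sub>1 = U k\<^sub>1\<close> and \<open>Q\<^sub>1 = V k\<^sub>1\<close>, the cell \<open>H\<^sub>1 \<inter> H\<^sub>3\<close> contains no element of \<open>P\<close>
  and all elements of \<open>Q\<^sub>1\<close>.
\<close>

lemma exists_exchange:
  assumes st: "state Z W P Q" and nob: "\<not> obstructed Z W P Q" and ne: "P \<noteq> {}"
  shows "\<exists>p\<in>P. \<exists>q\<in>Q. state (insert q Z) (insert p W) (P - {p}) (Q - {q})"
proof -
  have d: "Z \<inter> W = {}" "Z \<inter> P = {}" "Z \<inter> Q = {}" "W \<inter> P = {}" "W \<inter> Q = {}" "P \<inter> Q = {}"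
    and b: "base (Z \<union> P)" "base (Z \<union> Q)" "base (W \<union> P)" "base (W \<union> Q)"
    using st by (auto simp: state_def)
  note fin = state_finite[OF st]
  note PQ = state_card[OF st]
  have "\<exists>p\<in>P. \<exists>q\<in>Q. (\<forall>i. tight i (Z \<union> P) \<longrightarrow> q \<in> H i \<longrightarrow> p \<in> H i) \<and>
                     (\<forall>i. tight i (W \<union> Q) \<longrightarrow> p \<in> H i \<longrightarrow> q \<in> H i)"
  proof (rule ccontr)
    assume stuck: "\<not> ?thesis"
    \<comment> \<open>the flag tells which of the two current bases attains the bound of \<open>H i\<close>\<close>
    define K where "K = {(i, x). if x then tight i (Z \<union> P) else tight i (W \<union> Q)}"
    define U where "U = (\<lambda>(i, x). if x then P - H i else P \<inter> H i)"
    define V where "V = (\<lambda>(i, x). if x then Q \<inter> H i else Q - H i)"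
    have "\<exists>k1\<in>K. \<exists>k2\<in>K. \<exists>l1\<in>K. \<exists>l2\<in>K. snd k1 \<and> snd k2 \<and> \<not> snd l1 \<and> \<not> snd l2 \<and>
           U l1 = U k1 \<and> U k2 = P - U k1 \<and> U l2 = P - U k1 \<and>
           V l2 = V k1 \<and> V k2 = Q - V k1 \<and> V l1 = Q - V k1 \<and>
           2 * card (U k1) = card P \<and> 2 * card (V k1) = card P"
    proof (rule covering_rectangles[OF fin(3,4) PQ ne])
      show "U k \<subseteq> P \<and> V k \<subseteq> Q" for k by (auto simp: U_def V_def split: prod.splits)
      show "card (U k) + card (V k) \<le> card P" if k: "k \<in> K" for k
      proof (cases k)
        case (Pair i x)
        have iJ: "i \<in> J" using k Pair by (auto simp: K_def tight_def split: if_splits)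
        have c: "card (P \<inter> H i) + card (P - H i) = card P" "card (Q \<inter> H i) + card (Q - H i) = card Q"
          using card_Int_Diff[OF fin(3), of "H i"] card_Int_Diff[OF fin(4), of "H i"] by simp_all
        show ?thesis
        proof (cases x)
          case True
          then have "card ((Z \<union> Q) \<inter> H i) \<le> card ((Z \<union> P) \<inter> H i)"
            using b(2) k Pair iJ by (auto simp: K_def tight_def base_def)
          then have "card (Q \<inter> H i) \<le> card (P \<inter> H i)"
            using card_Un_Int_disjoint[of Z P "H i"] card_Un_Int_disjoint[of Z Q "H i"] fin d by simp
          then show ?thesis using c Pair True by (simp add: U_def V_def)
        next
          case False
          then have "card ((W \<union> P) \<inter> H i) \<le> card ((W \<union> Q) \<inter> H i)"
            using b(3) k Pair iJ by (auto simp: K_def tight_def base_def)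
          then have "card (P \<inter> H i) \<le> card (Q \<inter> H i)"
            using card_Un_Int_disjoint[of W P "H i"] card_Un_Int_disjoint[of W Q "H i"] fin d by simp
          then show ?thesis using c PQ Pair False by (simp add: U_def V_def)
        qed
      qed
      show "U k \<inter> U l = {} \<and> V k \<inter> V l = {}"
        if kK: "k \<in> K" "l \<in> K" "snd k = snd l" "k \<noteq> l" for k l
      proof -
        obtain i x j where kl: "k = (i, x)" "l = (j, x)" "i \<noteq> j"
          by (rule that[of "fst k" "snd k" "fst l"]) (use kK(3,4) in \<open>auto simp: prod_eq_iff\<close>)
        show ?thesis
        proof (cases x)
          case True
          then have "tight i (Z \<union> P)" "tight j (Z \<union> P)" using that kl by (auto simp: K_def)
          then have "Z \<union> P \<subseteq> H i \<union> H j" "H i \<inter> H j \<subseteq> Z \<union> P" using base_two_tight[OF b(1) _ _ kl(3)] by blast+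
          then show ?thesis using kl True d by (auto simp: U_def V_def)
        next
          case False
          then have "tight i (W \<union> Q)" "tight j (W \<union> Q)" using that kl by (auto simp: K_def)
          then have "W \<union> Q \<subseteq> H i \<union> H j" "H i \<inter> H j \<subseteq> W \<union> Q" using base_two_tight[OF b(4) _ _ kl(3)] by blast+
          then show ?thesis using kl False d by (auto simp: U_def V_def)
        qed
      qed
      show "\<exists>k\<in>K. p \<in> U k \<and> q \<in> V k" if pq: "p \<in> P" "q \<in> Q" for p q
      proof -
        from stuck pq consider i where "tight i (Z \<union> P)" "q \<in> H i" "p \<notin> H i"
          | i where "tight i (W \<union> Q)" "p \<in> H i" "q \<notin> H i" by blast
        then show ?thesis
        proof cases
          case 1
          then show ?thesis using pq by (intro bexI[of _ "(i, True)"]) (auto simp: K_def U_def V_def)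
        next
          case 2
          then show ?thesis using pq by (intro bexI[of _ "(i, False)"]) (auto simp: K_def U_def V_def)
        qed
      qed
    qed
    then obtain k1 k2 l1 l2 where kl: "k1 \<in> K" "k2 \<in> K" "l1 \<in> K" "l2 \<in> K"
      "snd k1" "snd k2" "\<not> snd l1" "\<not> snd l2"
      and R: "U l1 = U k1" "U k2 = P - U k1" "U l2 = P - U k1"
        "V l2 = V k1" "V k2 = Q - V k1" "V l1 = Q - V k1"
        "2 * card (U k1) = card P" "2 * card (V k1) = card P"
      by blast
    define h1 h2 h3 h4 where h: "h1 = fst k1" "h2 = fst k2" "h3 = fst l1" "h4 = fst l2"
    have e: "k1 = (h1, True)" "k2 = (h2, True)" "l1 = (h3, False)" "l2 = (h4, False)"
      using kl by (auto simp: h prod_eq_iff)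
    have T: "tight h1 (Z \<union> P)" "tight h2 (Z \<union> P)" "tight h3 (W \<union> Q)" "tight h4 (W \<union> Q)"
      using kl e by (auto simp: K_def)
    define P1 where "P1 = U k1"
    define Q1 where "Q1 = V k1"
    have sub: "P1 \<subseteq> P" "Q1 \<subseteq> Q" by (auto simp: P1_def Q1_def U_def V_def e)
    have PH: "P \<inter> H h1 = P - P1" "P \<inter> H h2 = P1" "P \<inter> H h3 = P1" "P \<inter> H h4 = P - P1"
      using R(1-3) by (auto simp: P1_def U_def e)
    have QH: "Q \<inter> H h1 = Q1" "Q \<inter> H h2 = Q - Q1" "Q \<inter> H h3 = Q1" "Q \<inter> H h4 = Q - Q1"
      using R(4-6) by (auto simp: Q1_def V_def e)
    have cP: "card P1 = card Q1" "card (P - P1) = card P1" "card (Q - Q1) = card Q1"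
      using R(7,8) sub PQ fin finite_subset[OF sub(1)] finite_subset[OF sub(2)]
      by (auto simp: card_Diff_subset P1_def Q1_def)
    have pos: "card P1 > 0" using R(7) ne fin card_gt_0_iff[of P] by (simp add: P1_def)
    have T': "tight h1 (Z \<union> Q)" "tight h2 (Z \<union> Q)" "tight h3 (W \<union> P)" "tight h4 (W \<union> P)"
      using T PH QH cP d fin by (auto simp: tight_def card_Un_Int_disjoint)
    have "h1 \<noteq> h2" "h3 \<noteq> h4"
      using PH pos by (metis Diff_disjoint Int_absorb card.empty less_irrefl)+
    moreover have "P \<inter> H h1 \<inter> H h3 = {}" "Q \<inter> H h1 \<inter> H h3 = Q1" using PH QH by auto
    ultimately have "obstruction h1 h2 h3 h4 Z W P Q"
      using T T' pos cP by (auto simp: obstruction_def)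
    then show False using nob by (auto simp: obstructed_def)
  qed
  then obtain p q where pq: "p \<in> P" "q \<in> Q"
     and ok: "\<And>i. tight i (Z \<union> P) \<Longrightarrow> q \<in> H i \<Longrightarrow> p \<in> H i"
     "\<And>i. tight i (W \<union> Q) \<Longrightarrow> p \<in> H i \<Longrightarrow> q \<in> H i" by blast
  have "base (insert q ((Z \<union> P) - {p}))"
    by (rule base_swap[OF b(1)]) (use d ok pq in auto)
  moreover have "insert q ((Z \<union> P) - {p}) = insert q Z \<union> (P - {p})" using d pq by auto
  ultimately have 1: "base (insert q Z \<union> (P - {p}))" by (simp only:)
  have "base (insert p ((W \<union> Q) - {q}))"
    by (rule base_swap[OF b(4)]) (use d ok pq in auto)
  moreover have "insert p ((W \<union> Q) - {q}) = insert p W \<union> (Q - {q})" using d pq by auto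
  ultimately have 2: "base (insert p W \<union> (Q - {q}))" by (simp only:)
  have "insert q Z \<union> (Q - {q}) = Z \<union> Q" "insert p W \<union> (P - {p}) = W \<union> P" using pq by auto
  then have 3: "base (insert q Z \<union> (Q - {q}))" "base (insert p W \<union> (P - {p}))"
    using b by (simp_all only:)
  have "state (insert q Z) (insert p W) (P - {p}) (Q - {q})" unfolding state_def
    by (intro conjI 1 2 3) (use d pq in auto)
  then show ?thesis using pq by blast
qed

text \<open>
  Suppose that every possible exchange creates an obstruction, and take one such exchange of \<open>w\<close> and \<open>z\<close>.  By
  \<open>avoid_obstruction\<close>, and by its mirror image with the two bases interchanged, both \<open>w\<close> and \<open>z\<close> lie in exactly one of \<open>H\<^sub>1, H\<^sub>2\<close>
  and in exactly one of \<open>H\<^sub>3, H\<^sub>4\<close>.  As the pair before the exchange consists of bases too, the two elements lie in the same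
  cell.  Undoing the exchange therefore changes neither tightness nor the difference of the cell sizes, and the
  obstruction was present before.
\<close>

lemma exists_good_exchange:
  assumes st: "state Z W P Q" and nob: "\<not> obstructed Z W P Q" and ne: "P \<noteq> {}"
  shows "\<exists>p\<in>P. \<exists>q\<in>Q. state (insert q Z) (insert p W) (P - {p}) (Q - {q}) \<and>
           \<not> obstructed (insert q Z) (insert p W) (P - {p}) (Q - {q})"
proof (rule ccontr)
  assume stuck: "\<not> ?thesis"
  obtain w z where wz: "w \<in> P" "z \<in> Q"
      and st1: "state (insert z Z) (insert w W) (P - {w}) (Q - {z})"
    using exists_exchange[OF st nob ne] by blast
  then obtain h1 h2 h3 h4
    where ob: "obstruction h1 h2 h3 h4 (insert z Z) (insert w W) (P - {w}) (Q - {z})"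
    using stuck unfolding obstructed_def by blast
  have d: "Z \<inter> W = {}" "Z \<inter> P = {}" "Z \<inter> Q = {}" "W \<inter> P = {}" "W \<inter> Q = {}" "P \<inter> Q = {}"
    and b: "base (Z \<union> P)" "base (Z \<union> Q)" "base (W \<union> P)" "base (W \<union> Q)"
    using st by (auto simp: state_def)
  note fin = state_finite[OF st]
  note cells = obstruction_cells[OF st1 ob]
  have w_exact: "w \<in> H h1 \<union> H h2" "w \<notin> H h3 \<inter> H h4"
  proof -
    have "\<not> (w \<notin> H h1 \<union> H h2 \<or> w \<in> H h3 \<inter> H h4)"
    proof
      assume inexact: "w \<notin> H h1 \<union> H h2 \<or> w \<in> H h3 \<inter> H h4"
      obtain p where p: "p \<in> P - {w}"
        and n: "state (insert z Z) (insert p (insert w W - {w})) (insert w (P - {w} - {p})) (Q - {z}) \<and>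
          \<not> obstructed (insert z Z) (insert p (insert w W - {w})) (insert w (P - {w} - {p})) (Q - {z})"
        using avoid_obstruction[OF st1 ob insertI1 inexact] by blast
      have "insert w W - {w} = W" "insert w (P - {w} - {p}) = P - {p}" using p wz d by auto
      then show False using n stuck p wz by (metis DiffD1)
    qed
    then show "w \<in> H h1 \<union> H h2" "w \<notin> H h3 \<inter> H h4" by blast+
  qed
  have z_exact: "z \<in> H h3 \<union> H h4" "z \<notin> H h1 \<inter> H h2"
  proof -
    have "\<not> (z \<notin> H h3 \<union> H h4 \<or> z \<in> H h1 \<inter> H h2)"
    proof
      assume inexact: "z \<notin> H h3 \<union> H h4 \<or> z \<in> H h1 \<inter> H h2"
      obtain q where q: "q \<in> Q - {z}"
        and n: "state (insert w W) (insert q (insert z Z - {z})) (insert z (Q - {z} - {q})) (P - {w}) \<and>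
          \<not> obstructed (insert w W) (insert q (insert z Z - {z})) (insert z (Q - {z} - {q})) (P - {w})"
        using avoid_obstruction[OF state_swap[OF st1] obstruction_swap[OF ob] insertI1 inexact] by blast
      have e: "insert z Z - {z} = Z" "insert z (Q - {z} - {q}) = Q - {q}" using q wz d by auto
      have "state (insert q Z) (insert w W) (P - {w}) (Q - {q})"
        using state_swap n unfolding e by blast
      moreover have "\<not> obstructed (insert q Z) (insert w W) (P - {w}) (Q - {q})"
        using obstructed_swap n unfolding e by blast
      ultimately show False using stuck q wz by (metis DiffD1)
    qed
    then show "z \<in> H h3 \<union> H h4" "z \<notin> H h1 \<inter> H h2" by blast+
  qed
  have t1: "tight h1 (insert z Z \<union> (P - {w}))" "tight h2 (insert z Z \<union> (P - {w}))"
       "tight h3 (insert w W \<union> (Q - {z}))" "tight h4 (insert w W \<union> (Q - {z}))"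
    using ob by (auto simp: obstruction_def)
  define X where "X = insert z Z \<union> (P - {w})"
  define Y where "Y = insert w W \<union> (Q - {z})"
  have X: "insert w (X - {z}) = Z \<union> P" "z \<in> X" "w \<notin> X" "finite X"
    using wz d fin by (auto simp: X_def)
  have Y: "insert z (Y - {w}) = W \<union> Q" "w \<in> Y" "z \<notin> Y" "finite Y"
    using wz d fin by (auto simp: Y_def)
  have wz_X: "z \<in> H h" if "h \<in> {h1, h2}" "w \<in> H h" for h
    using tight_swap_mem[OF _ X(4,2,3), of h] that t1(1,2) b(1) unfolding X_def[symmetric] X(1) by auto
  have wz_Y: "w \<in> H h" if "h \<in> {h3, h4}" "z \<in> H h" for h
    using tight_swap_mem[OF _ Y(4,2,3), of h] that t1(3,4) b(4) unfolding Y_def[symmetric] Y(1) by auto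
  have same: "w \<in> H h1 \<longleftrightarrow> z \<in> H h1" "w \<in> H h2 \<longleftrightarrow> z \<in> H h2"
      "w \<in> H h3 \<longleftrightarrow> z \<in> H h3" "w \<in> H h4 \<longleftrightarrow> z \<in> H h4"
    using wz_X[of h1] wz_X[of h2] wz_Y[of h3] wz_Y[of h4] w_exact z_exact by auto
  have T: "tight h1 (Z \<union> P)" "tight h2 (Z \<union> P)" "tight h3 (W \<union> Q)" "tight h4 (W \<union> Q)"
    using t1 same tight_swap_iff[OF X(4,2,3)] tight_swap_iff[OF Y(4,2,3)]
    unfolding X_def[symmetric] Y_def[symmetric] X(1) Y(1) by blast+
  have "insert z Z \<union> (Q - {z}) = Z \<union> Q" "insert w W \<union> (P - {w}) = W \<union> P" using wz by auto
  then have T': "tight h1 (Z \<union> Q)" "tight h2 (Z \<union> Q)" "tight h3 (W \<union> P)" "tight h4 (W \<union> P)"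
    using ob unfolding obstruction_def by simp_all
  have cnt: "card (R \<inter> H h1 \<inter> H h3) = card ((R - {e}) \<inter> H h1 \<inter> H h3) + of_bool (e \<in> H h1 \<inter> H h3)"
    if "finite R" "e \<in> R" for R e
  proof (cases "e \<in> H h1 \<inter> H h3")
    case True
    have "(R - {e}) \<inter> H h1 \<inter> H h3 = (R \<inter> H h1 \<inter> H h3) - {e}" by auto
    then show ?thesis using that True card_Suc_Diff1[of "R \<inter> H h1 \<inter> H h3" e] by simp
  next
    case False
    then have "(R - {e}) \<inter> H h1 \<inter> H h3 = R \<inter> H h1 \<inter> H h3" by auto
    then show ?thesis using False by simp
  qed
  have "card (P \<inter> H h1 \<inter> H h3) \<noteq> card (Q \<inter> H h1 \<inter> H h3)"
    using ob cnt[OF fin(3) wz(1)] cnt[OF fin(4) wz(2)] same unfolding obstruction_def by simp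
  then have "obstruction h1 h2 h3 h4 Z W P Q"
    using T T' ob unfolding obstruction_def by blast
  then show False using nob by (auto simp: obstructed_def)
qed

lemma serial_exchange_state:
  assumes "state Z W P Q" "\<not> obstructed Z W P Q"
  shows "serial_exchange (\<lambda>X. base (W \<union> X)) (\<lambda>X. base (Z \<union> X)) P Q"
  using assms
proof (induction "card P" arbitrary: Z W P Q)
  case 0
  then have "P = {}" "Q = {}" using state_finite[OF 0(2)] state_card[OF 0(2)] by auto
  then show ?case using 0(2) by (auto simp: state_def intro: serial_exchange_refl)
next
  case (Suc n)
  have "P \<noteq> {}" using Suc.hyps by auto
  then obtain p q where pq: "p \<in> P" "q \<in> Q"
    and st: "state (insert q Z) (insert p W) (P - {p}) (Q - {q})"
    and nob: "\<not> obstructed (insert q Z) (insert p W) (P - {p}) (Q - {q})"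
    using exists_good_exchange[OF Suc.prems] by blast
  have "n = card (P - {p})" using Suc.hyps pq by simp
  note IH = Suc.hyps(1)[OF this st nob]
  have "serial_exchange (\<lambda>X. base (W \<union> X)) (\<lambda>X. base (Z \<union> X)) (insert p (P - {p})) (insert q (Q - {q}))"
  proof (rule serial_exchange_Cons[OF IH])
    show "base (W \<union> insert q (Q - {q}))" "base (Z \<union> insert p (P - {p}))"
      using Suc.prems pq by (simp_all add: insert_absorb state_def)
  qed (use pq in simp_all)
  then show ?case using pq by (simp add: insert_absorb)
qed

lemma serial_exchange_disjoint_bases:
  assumes A: "base A" and B: "base B" and AB: "A \<inter> B = {}"
  shows "serial_exchange base base A B"
proof -
  have "state {} {} A B" using assms by (simp add: state_def)
  moreover have "\<not> obstructed {} {} A B"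
  proof
    assume "obstructed {} {} A B"
    then obtain h1 h2 h3 h4 where "obstruction h1 h2 h3 h4 {} {} A B" by (auto simp: obstructed_def)
    then have t: "tight h1 A" "tight h3 A" "tight h1 B" "tight h3 B"
        "card (A \<inter> H h1 \<inter> H h3) \<noteq> card (B \<inter> H h1 \<inter> H h3)"
      by (auto simp: obstruction_def)
    show False
    proof (cases "h1 = h3")
      case True
      then show ?thesis using t by (simp add: tight_def Int_assoc)
    next
      case False
      then have "H h1 \<inter> H h3 \<subseteq> A \<inter> B"
        using base_two_tight(2)[OF A t(1,2)] base_two_tight(2)[OF B t(3,4)] by blast
      then have "A \<inter> H h1 \<inter> H h3 = {}" "B \<inter> H h1 \<inter> H h3 = {}" using AB by auto
      then show ?thesis using t(5) by simp
    qed
  qed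
  ultimately show ?thesis using serial_exchange_state[of "{}" "{}" A B] by simp
qed

end

section \<open>Circuits and connected components\<close>

context matroid
begin

lemma indep_finite: "I X \<Longrightarrow> finite X"
  using indep_subset_ground finite_ground finite_subset by blast

lemma dependent_contains_circuit:
  assumes "X \<subseteq> S" "\<not> I X"
  shows "\<exists>C\<subseteq>X. circuit S I C"
proof -
  have "finite X" using assms finite_ground finite_subset by blast
  then show ?thesis using assms
  proof (induction X rule: finite_psubset_induct)
    case (psubset X)
    show ?case
    proof (cases "\<exists>Y. Y \<subset> X \<and> \<not> I Y")
      case True
      then show ?thesis using psubset by (meson order_trans psubset_imp_subset)
    next
      case False
      then show ?thesis using psubset.prems by (auto simp: circuit_def)
    qed
  qed
qed

lemma circuit_not_psubset: "circuit S I C \<Longrightarrow> circuit S I D \<Longrightarrow> C \<subseteq> D \<Longrightarrow> C = D"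
  unfolding circuit_def by blast

lemma circuit_Diff_indep: "circuit S I C \<Longrightarrow> x \<in> C \<Longrightarrow> I (C - {x})"
  unfolding circuit_def by blast

lemma extend_to_maximal:
  assumes "I X" "X \<subseteq> Y"
  shows "\<exists>J. X \<subseteq> J \<and> J \<subseteq> Y \<and> I J \<and> (\<forall>y\<in>Y - J. \<not> I (insert y J))"
proof -
  let ?P = "\<lambda>J. X \<subseteq> J \<and> J \<subseteq> Y \<and> I J"
  have "?P X" using assms by simp
  moreover have "\<forall>L. ?P L \<longrightarrow> card L < Suc (card S)"
    using indep_subset_ground card_mono[OF finite_ground] by (simp add: less_Suc_eq_le)
  ultimately have "\<exists>J. ?P J \<and> (\<forall>L. ?P L \<longrightarrow> card L \<le> card J)"
    by (rule ex_has_greatest_nat)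
  then obtain J where J: "?P J" and max: "\<And>L. ?P L \<Longrightarrow> card L \<le> card J" by blast
  have "\<not> I (insert y J)" if "y \<in> Y - J" for y
  proof
    assume "I (insert y J)"
    then have "card (insert y J) \<le> card J" using max[of "insert y J"] J that by auto
    then show False using that J indep_finite[of J] by auto
  qed
  then show ?thesis using J by blast
qed

text \<open>
  Extend \<open>D - {e}\<close> to a maximal independent subset \<open>J\<close> of \<open>(C \<union> D) - {e, f}\<close>.  As \<open>J\<close> spans \<open>e\<close>, it is maximal even in
  \<open>(C \<union> D) - {f}\<close>, and that set spans \<open>f\<close> because of \<open>C\<close>.  So \<open>J\<close> together with \<open>f\<close> is dependent, and it
  contains a circuit through \<open>f\<close>.
\<close>

lemma strong_circuit_elimination:
  assumes C: "circuit S I C" and D: "circuit S I D" and e: "e \<in> C \<inter> D" and f: "f \<in> C - D"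
  shows "\<exists>E. circuit S I E \<and> f \<in> E \<and> E \<subseteq> C \<union> D - {e}"
proof -
  let ?Y = "C \<union> D"
  have YS: "?Y \<subseteq> S" using C D by (auto simp: circuit_def)
  obtain J where J: "D - {e} \<subseteq> J" "J \<subseteq> ?Y - {e, f}" "I J"
      and Jmax: "\<And>y. y \<in> ?Y - {e, f} - J \<Longrightarrow> \<not> I (insert y J)"
    using extend_to_maximal[OF circuit_Diff_indep[OF D], of e "?Y - {e, f}"] e f by blast
  have Jmax': "\<not> I (insert y J)" if "y \<in> ?Y - {f} - J" for y
  proof (cases "y = e")
    case True
    then have "D \<subseteq> insert y J" using J by auto
    then show ?thesis using D indep_subset by (auto simp: circuit_def)
  next
    case False
    then show ?thesis using Jmax that by auto
  qed
  have dep: "\<not> I (insert f J)"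
  proof
    assume If: "I (insert f J)"
    obtain L where L: "C - {f} \<subseteq> L" "L \<subseteq> ?Y - {f}" "I L"
        and Lmax: "\<And>y. y \<in> ?Y - {f} - L \<Longrightarrow> \<not> I (insert y L)"
      using extend_to_maximal[OF circuit_Diff_indep[OF C], of f "?Y - {f}"] f by blast
    have "\<not> card J < card L"
      using augment[OF J(3) L(3)] Jmax' L(2) by blast
    moreover have "f \<notin> J" using J by auto
    ultimately have "card L < card (insert f J)" using indep_finite[OF J(3)] by simp
    then obtain y where y: "y \<in> insert f J - L" "I (insert y L)" using augment[OF L(3) If] by blast
    show False
    proof (cases "y = f")
      case True
      then have "C \<subseteq> insert y L" using L by auto
      then show ?thesis using y C indep_subset by (auto simp: circuit_def)
    next
      case False
      then show ?thesis using Lmax[of y] y J by auto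
    qed
  qed
  have "insert f J \<subseteq> S" using J YS f by auto
  then obtain E where E: "E \<subseteq> insert f J" "circuit S I E"
    using dependent_contains_circuit dep by blast
  have "f \<in> E" using E J(3) indep_subset by (metis circuit_def subset_insert)
  moreover have "E \<subseteq> ?Y - {e}" using E J e f by auto
  ultimately show ?thesis using E by blast
qed

text \<open>
  Induction on \<open>|C \<union> D|\<close>.  Eliminating a common element \<open>e\<close> gives circuits \<open>E\<close> through \<open>x\<close> and \<open>F\<close> through \<open>z\<close>.
  If neither of the pairs \<open>E, D\<close> and \<open>C, F\<close> has a smaller union, then \<open>C - D \<subseteq> E\<close>, so \<open>F\<close>, which is not contained in \<open>D\<close>, meets \<open>E\<close>; and \<open>E \<union> F\<close> misses \<open>e\<close>.
\<close>

lemma circuits_meeting_joined: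
  assumes "circuit S I C" "circuit S I D" "C \<inter> D \<noteq> {}" "x \<in> C" "z \<in> D"
  shows "\<exists>E. circuit S I E \<and> x \<in> E \<and> z \<in> E"
  using assms
proof (induction "card (C \<union> D)" arbitrary: C D rule: less_induct)
  case less
  have smaller: "card (C' \<union> D') < card (C \<union> D)" if "C' \<union> D' \<subset> C \<union> D" for C' D'
    using that less.prems finite_ground
    by (metis circuit_def finite_UnI finite_subset psubset_card_mono)
  show ?case
  proof (cases "x \<in> D \<or> z \<in> C")
    case True
    then show ?thesis using less.prems by blast
  next
    case False
    obtain e where e: "e \<in> C \<inter> D" using less.prems by blast
    obtain E where E: "circuit S I E" "x \<in> E" "E \<subseteq> C \<union> D - {e}"
      using strong_circuit_elimination[OF less.prems(1,2) e, of x] False less.prems by blast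
    obtain F where F: "circuit S I F" "z \<in> F" "F \<subseteq> D \<union> C - {e}"
      using strong_circuit_elimination[OF less.prems(2,1), of e z] e False less.prems by blast
    have ED: "E \<inter> D \<noteq> {}"
      using circuit_not_psubset[OF E(1) less.prems(1)] E e by blast
    have FC: "C \<inter> F \<noteq> {}"
      using circuit_not_psubset[OF F(1) less.prems(2)] F e by blast
    show ?thesis
    proof (cases "E \<union> D \<subset> C \<union> D \<or> C \<union> F \<subset> C \<union> D")
      case True
      then show ?thesis
        using less.hyps[OF smaller E(1) less.prems(2) ED E(2) less.prems(5)]
          less.hyps[OF smaller less.prems(1) F(1) FC less.prems(4) F(2)] by blast
    next
      case False
      then have "C - D \<subseteq> E" using E by blast
      moreover have "F \<inter> (C - D) \<noteq> {}"
        using circuit_not_psubset[OF F(1) less.prems(2)] F e by blast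
      ultimately have EF: "E \<inter> F \<noteq> {}" by blast
      have "E \<union> F \<subset> C \<union> D" using E F e by blast
      then show ?thesis using less.hyps[OF smaller E(1) F(1) EF E(2) F(2)] by blast
    qed
  qed
qed

lemma equiv_connected_rel: "equiv S (connected_rel S I)"
proof (rule equivI)
  show "connected_rel S I \<subseteq> S \<times> S" by (auto simp: connected_rel_def)
  show "refl_on S (connected_rel S I)" by (auto simp: refl_on_def connected_rel_def)
  show "sym (connected_rel S I)" by (auto simp: sym_def connected_rel_def)
  show "trans (connected_rel S I)"
  proof (rule transI)
    fix x y z
    assume xy: "(x, y) \<in> connected_rel S I" and yz: "(y, z) \<in> connected_rel S I"
    show "(x, z) \<in> connected_rel S I"
    proof (cases "x = y \<or> y = z")
      case False
      then obtain C D where "circuit S I C" "x \<in> C" "y \<in> C" "circuit S I D" "y \<in> D" "z \<in> D"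
        using xy yz by (auto simp: connected_rel_def)
      then have "\<exists>E. circuit S I E \<and> x \<in> E \<and> z \<in> E"
        using circuits_meeting_joined by blast
      then show ?thesis using xy yz by (auto simp: connected_rel_def)
    qed (use xy yz in auto)
  qed
qed

lemma components_disjoint:
  "K \<in> components S I \<Longrightarrow> L \<in> components S I \<Longrightarrow> K \<noteq> L \<Longrightarrow> K \<inter> L = {}"
  using quotient_disj[OF equiv_connected_rel] by (auto simp: components_def)

lemma Union_components: "\<Union>(components S I) = S"
  using Union_quotient[OF equiv_connected_rel] by (simp add: components_def)

lemma finite_components: "finite (components S I)"
  using finite_quotient[OF finite_ground] equiv_type[OF equiv_connected_rel]
  by (simp add: components_def)

lemma circuit_in_component:
  assumes "circuit S I C" "x \<in> C" "x \<in> K" "K \<in> components S I"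
  shows "C \<subseteq> K"
proof
  fix y assume "y \<in> C"
  then have "(x, y) \<in> connected_rel S I" using assms by (auto simp: connected_rel_def circuit_def)
  then show "y \<in> K"
    using in_quotient_imp_closed[OF equiv_connected_rel _ assms(3)] assms(4) by (simp add: components_def)
qed

text \<open>
  A circuit lies within one component, so a circuit in the union would lie in \<open>X\<close> or in \<open>Y\<close>.
\<close>

lemma indep_Un_separated:
  assumes X: "I X" and Y: "I Y"
    and sep: "\<And>K. K \<in> components S I \<Longrightarrow> X \<inter> K = {} \<or> Y \<inter> K = {}"
  shows "I (X \<union> Y)"
proof (rule ccontr)
  assume "\<not> I (X \<union> Y)"
  moreover have "X \<union> Y \<subseteq> S" using indep_subset_ground[OF X] indep_subset_ground[OF Y] by simp
  ultimately obtain C where C: "C \<subseteq> X \<union> Y" "circuit S I C"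
    using dependent_contains_circuit by blast
  have dep: "\<not> I C" and CS: "C \<subseteq> S" using C(2) by (simp_all add: circuit_def)
  have "C \<noteq> {}" using dep indep_empty by auto
  then obtain x where x: "x \<in> C" by blast
  then have "x \<in> \<Union>(components S I)" using Union_components CS by auto
  then obtain K where K: "K \<in> components S I" "x \<in> K" by blast
  have "C \<subseteq> K" using circuit_in_component[OF C(2) x K(2,1)] .
  then have "C \<subseteq> X \<or> C \<subseteq> Y" using sep[OF K(1)] C(1) by blast
  then show False using dep indep_subset[OF X, of C] indep_subset[OF Y, of C] by blast
qed

lemma basis_Int_component:
  assumes A: "basis I A" and K: "K \<in> components S I"
  shows "basis (restriction I K) (A \<inter> K)"
proof -
  have IA: "I A" using A by (simp add: basis_def)
  have "X = A \<inter> K" if X: "X \<subseteq> K" "I X" "A \<inter> K \<subseteq> X" for X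
  proof -
    have "I ((A - K) \<union> X)"
    proof (rule indep_Un_separated)
      fix L assume L: "L \<in> components S I"
      show "(A - K) \<inter> L = {} \<or> X \<inter> L = {}"
        using components_disjoint[OF K L] X(1) by blast
    qed (use X indep_subset[OF IA] in auto)
    moreover have "A \<subseteq> (A - K) \<union> X" using X by blast
    ultimately have "(A - K) \<union> X = A" using A by (auto simp: basis_def)
    then show ?thesis using X by blast
  qed
  then show ?thesis using indep_subset[OF IA] by (auto simp: basis_def restriction_def)
qed

lemma indep_card_le_basis:
  assumes "basis I B" "I X"
  shows "card X \<le> card B"
proof (rule ccontr)
  assume "\<not> card X \<le> card B"
  then obtain y where "y \<in> X - B" "I (insert y B)"
    using augment[of B X] assms by (auto simp: basis_def)
  then show False using assms(1) by (auto simp: basis_def)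
qed

lemma matroid_rank_eq_card_basis:
  assumes "basis I B"
  shows "matroid_rank I = card B"
  unfolding matroid_rank_def
proof (rule Max_eqI)
  have "{card X |X. I X} \<subseteq> {..card B}" using indep_card_le_basis[OF assms] by auto
  then show "finite {card X |X. I X}" using finite_subset by blast
qed (use assms indep_card_le_basis[OF assms] in \<open>auto simp: basis_def\<close>)

lemma basis_if_card_basis:
  assumes "basis I B" "I X" "card X = card B"
  shows "basis I X"
  unfolding basis_def
proof (intro conjI allI impI assms(2))
  fix Y assume Y: "I Y \<and> X \<subseteq> Y"
  then have "card Y \<le> card X" using indep_card_le_basis[OF assms(1)] assms(3) by simp
  then show "Y = X" using card_seteq[of Y X] Y indep_finite by blast
qed

end

section \<open>Serial exchange in split matroids\<close>

text \<open>
  Two facts reduce the claim to disjoint bases of a \<open>split_system\<close>.  Maximal independent sets have exactly \<open>r\<close>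
  elements: if a smaller one were blocked everywhere, then by \<open>two_tight\<close> a single \<open>H\<^sub>i\<close> would block all of \<open>K - X\<close>, so
  \<open>K - H\<^sub>i \<subseteq> X\<close> and \<open>r \<le> |K - H\<^sub>i| + \<rho>\<^sub>i \<le> |X|\<close>.  And contracting \<open>C = A \<inter> B\<close> replaces \<open>H\<^sub>i\<close> by \<open>H\<^sub>i - C\<close>, \<open>\<rho>\<^sub>i\<close> by \<open>\<rho>\<^sub>i - |C \<inter> H\<^sub>i|\<close>
  and \<open>r\<close> by \<open>r - |C|\<close>, which again is a \<open>split_system\<close>.
\<close>

lemma split_system_serial_exchange:
  fixes H :: "'i \<Rightarrow> 'a set"
  assumes finK: "finite K" and rK: "r \<le> card K" and HK: "\<And>i. i \<in> J \<Longrightarrow> H i \<subseteq> K"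
    and cross: "\<And>i j. i \<in> J \<Longrightarrow> j \<in> J \<Longrightarrow> i \<noteq> j \<Longrightarrow> card (H i \<inter> H j) + r \<le> \<rho> i + \<rho> j"
    and slack: "\<And>i. i \<in> J \<Longrightarrow> r \<le> card (K - H i) + \<rho> i"
    and I: "\<And>X. I X \<longleftrightarrow> X \<subseteq> K \<and> card X \<le> r \<and> (\<forall>i\<in>J. card (X \<inter> H i) \<le> \<rho> i)"
    and A: "basis I A" and B: "basis I B"
  shows "serial_exchange (\<lambda>X. I X \<and> card X = card A) (\<lambda>X. I X \<and> card X = card A) A B"
proof -
  have finH: "finite (H i)" if "i \<in> J" for i using HK[OF that] finK by (rule finite_subset)
  interpret full: split_system J H \<rho> r
    by (rule split_system.intro) (fact finH cross)+
  have card_basis: "card X = r" if X: "basis I X" for X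
  proof (rule ccontr)
    assume "card X \<noteq> r"
    then have less: "card X < r" using X I by (simp add: basis_def)
    have XK: "X \<subseteq> K" using X I by (simp add: basis_def)
    have finX: "finite X" using XK finK finite_subset by blast
    have blocked: "\<exists>i. full.tight i X \<and> y \<in> H i" if y: "y \<in> K - X" for y
    proof -
      have "\<not> I (insert y X)" using X y unfolding basis_def by blast
      then obtain i where i: "i \<in> J" "\<not> card (insert y X \<inter> H i) \<le> \<rho> i"
        using less finX XK y by (auto simp: I)
      have "card (X \<inter> H i) \<le> \<rho> i" using X i(1) by (simp add: basis_def I)
      then have "y \<in> H i \<and> card (X \<inter> H i) = \<rho> i"
        using i(2) finX y by (cases "y \<in> H i") simp_all
      then show ?thesis using i(1) unfolding full.tight_def by blast
    qed
    have "card X < card K" using less rK by simp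
    then obtain y where y: "y \<in> K - X" using XK by (metis DiffI nat_neq_iff subsetI subset_antisym)
    obtain i where i: "full.tight i X" "y \<in> H i" using blocked[OF y] by blast
    have iq: "i \<in> J" "card (X \<inter> H i) = \<rho> i" using i(1) unfolding full.tight_def by blast+
    have "K - X \<subseteq> H i"
    proof
      fix x assume "x \<in> K - X"
      then obtain j where j: "full.tight j X" "x \<in> H j" using blocked by blast
      have "j = i" using full.two_tight(3)[OF finX _ j(1) i(1)] less by auto
      then show "x \<in> H i" using j by simp
    qed
    then have "card (K - H i) \<le> card (X - H i)" using finX by (intro card_mono) auto
    moreover have "card X = card (X \<inter> H i) + card (X - H i)" using card_Int_Diff[OF finX] .
    ultimately show False using slack[OF iq(1)] iq(2) less by simp
  qed
  define C where "C = A \<inter> B"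
  define H' where "H' = (\<lambda>i. H i - C)"
  define \<rho>' where "\<rho>' = (\<lambda>i. \<rho> i - card (C \<inter> H i))"
  define r' where "r' = r - card C"
  have cA: "card A = r" "card B = r" using card_basis A B by auto
  have IAB: "I A" "I B" using A B by (auto simp: basis_def)
  then have AK: "A \<subseteq> K" "B \<subseteq> K" by (simp_all add: I)
  have fin: "finite A" "finite B" "finite C"
    using finite_subset[OF AK(1) finK] finite_subset[OF AK(2) finK] by (simp_all add: C_def)
  have Cr: "card C \<le> r" using cA fin card_mono[of A C] by (auto simp: C_def)
  have le\<rho>: "card (A \<inter> H i) \<le> \<rho> i" "card (B \<inter> H i) \<le> \<rho> i" if "i \<in> J" for i
    using IAB that by (auto simp: I)
  have C\<rho>: "card (C \<inter> H i) \<le> \<rho> i" if "i \<in> J" for i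
  proof -
    have "C \<inter> H i \<subseteq> A \<inter> H i" by (auto simp: C_def)
    then show ?thesis using le\<rho>(1)[OF that] card_mono[of "A \<inter> H i" "C \<inter> H i"] fin by simp
  qed
  have split: "card (Y \<inter> H i) = card (C \<inter> H i) + card ((Y - C) \<inter> H' i)" if "C \<subseteq> Y" "finite Y" for Y i
  proof -
    have "Y \<inter> H i = (C \<inter> H i) \<union> ((Y - C) \<inter> H' i)" using that by (auto simp: H'_def)
    moreover have "(C \<inter> H i) \<inter> ((Y - C) \<inter> H' i) = {}" by auto
    ultimately show ?thesis using that fin by (simp add: card_Un_disjoint)
  qed
  interpret contracted: split_system "J" H' \<rho>' r'
  proof
    show "finite (H' i)" if "i \<in> J" for i using finH[OF that] by (simp add: H'_def)
    fix i j assume ij: "i \<in> J" "j \<in> J" "i \<noteq> j"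
    \<comment> \<open>contraction lowers \<open>\<rho> i + \<rho> j\<close> by at most \<open>|C| + |C \<inter> H i \<inter> H j|\<close>, which is what the other side loses\<close>
    have "card (C \<inter> H i) + card (C \<inter> H j) = card (C \<inter> (H i \<union> H j)) + card (C \<inter> (H i \<inter> H j))"
      using card_Un_Int[of "C \<inter> H i" "C \<inter> H j"] fin
      by (simp add: Int_Un_distrib Int_assoc Int_left_commute)
    moreover have "card (C \<inter> (H i \<union> H j)) \<le> card C" using fin by (auto intro: card_mono)
    moreover have "card (H i \<inter> H j) = card (C \<inter> (H i \<inter> H j)) + card (H' i \<inter> H' j)"
    proof -
      have "H i \<inter> H j - C = H' i \<inter> H' j" by (auto simp: H'_def)
      then show ?thesis
        using card_Int_Diff[of "H i \<inter> H j" C] finH[OF ij(1)] by (simp add: Int_commute)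
    qed
    ultimately show "card (H' i \<inter> H' j) + r' \<le> \<rho>' i + \<rho>' j"
      using cross[OF ij] C\<rho>[OF ij(1)] C\<rho>[OF ij(2)] Cr by (simp add: r'_def \<rho>'_def)
  qed
  have "contracted.base (Y - C)" if "Y \<in> {A, B}" for Y
  proof -
    have Y: "C \<subseteq> Y" "finite Y" "card Y = r" using that fin cA by (auto simp: C_def)
    have "card ((Y - C) \<inter> H' i) \<le> \<rho>' i" if i: "i \<in> J" for i
      using split[OF Y(1,2), of i] le\<rho>[OF i] \<open>Y \<in> {A, B}\<close> by (auto simp: \<rho>'_def)
    moreover have "finite (Y - C)" "card (Y - C) = r'"
      using Y fin by (simp_all add: card_Diff_subset r'_def)
    ultimately show ?thesis unfolding contracted.base_def by blast
  qed
  then have "serial_exchange contracted.base contracted.base (A - C) (B - C)"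
    by (intro contracted.serial_exchange_disjoint_bases) (auto simp: C_def)
  then have "serial_exchange (\<lambda>X. I X \<and> card X = card A) (\<lambda>X. I X \<and> card X = card A)
      (C \<union> (A - C)) (C \<union> (B - C))"
  proof (rule serial_exchange_append[rotated])
    show "serial_exchange (\<lambda>X. X = C) (\<lambda>X. X = C) C C" by (intro serial_exchange_refl fin) auto
    fix X Y assume X: "X = C" and Y: "Y \<subseteq> A - C \<union> (B - C)" "contracted.base Y"
    have Y': "finite Y" "card Y = r'" "\<And>i. i \<in> J \<Longrightarrow> card (Y \<inter> H' i) \<le> \<rho>' i"
      using Y(2) by (auto simp: contracted.base_def)
    have e: "(C \<union> Y) - C = Y" using Y by auto
    have c: "card (C \<union> Y) = r"
      using card_Un_disjoint[of C Y] fin Y' Y(1) Cr by (auto simp: r'_def)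
    have "card ((C \<union> Y) \<inter> H i) \<le> \<rho> i" if i: "i \<in> J" for i
      using split[of "C \<union> Y" i] Y'(1) Y'(3)[OF i] C\<rho>[OF i] fin e by (simp add: \<rho>'_def)
    moreover have "C \<union> Y \<subseteq> K" using AK Y(1) by (auto simp: C_def)
    ultimately have "I (C \<union> Y)" using c by (simp add: I)
    then show "I (X \<union> Y) \<and> card (X \<union> Y) = card A" using X c cA by simp
    then show "I (X \<union> Y) \<and> card (X \<union> Y) = card A" .
  qed auto
  moreover have "C \<union> (A - C) = A" "C \<union> (B - C) = B" by (auto simp: C_def)
  ultimately show ?thesis by simp
qed

lemma elementary_split_serial_exchange:
  assumes es: "elementary_split_matroid K I" and A: "basis I A" and B: "basis I B"
  shows "serial_exchange (\<lambda>X. I X \<and> card X = card A) (\<lambda>X. I X \<and> card X = card A) A B"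
  using es unfolding elementary_split_matroid_def
proof (elim conjE exE)
  fix r q :: nat and \<rho> :: "nat \<Rightarrow> nat" and H :: "nat \<Rightarrow> 'a set"
  assume finK: "finite K" and rK: "r \<le> card K" and HK: "\<forall>i\<in>{1..q}. H i \<subseteq> K"
    and cross: "\<forall>i\<in>{1..q}. \<forall>j\<in>{1..q}. i < j \<longrightarrow> card (H i \<inter> H j) + r \<le> \<rho> i + \<rho> j"
    and slack: "\<forall>i\<in>{1..q}. r \<le> card (K - H i) + \<rho> i"
    and I: "\<forall>X. I X \<longleftrightarrow> X \<subseteq> K \<and> card X \<le> r \<and> (\<forall>i\<in>{1..q}. card (X \<inter> H i) \<le> \<rho> i)"
  have cross': "card (H i \<inter> H j) + r \<le> \<rho> i + \<rho> j"
    if "i \<in> {1..q}" "j \<in> {1..q}" "i \<noteq> j" for i j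
  proof (cases "i < j")
    case True
    then show ?thesis using cross that(1,2) by blast
  next
    case False
    then have "j < i" using that(3) by simp
    then have "card (H j \<inter> H i) + r \<le> \<rho> j + \<rho> i" using cross that(1,2) by blast
    then show ?thesis by (simp add: Int_commute add.commute)
  qed
  show ?thesis
    by (rule split_system_serial_exchange[OF finK rK HK[rule_format] cross' slack[rule_format]
          I[rule_format] A B])
qed

lemma uniform_imp_elementary_split:
  assumes "uniform_matroid S I"
  shows "elementary_split_matroid S I"
proof -
  obtain k where k: "finite S" "k \<le> card S" "\<And>X. I X \<longleftrightarrow> X \<subseteq> S \<and> card X \<le> k"
    using assms unfolding uniform_matroid_def by blast
  show ?thesis unfolding elementary_split_matroid_def
    by (intro conjI exI[of _ k] exI[of _ "0::nat"]) (simp_all add: k)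
qed

text \<open>
  Keeping track of cardinalities is a substitute for speaking of bases: an independent set of the cardinality of
  a basis is a basis, and this property passes from the components to their union.
\<close>

lemma split_serial_exchange:
  assumes M: "split_matroid S I" and A: "basis I A" and B: "basis I B"
  shows "serial_exchange (\<lambda>X. I X \<and> card X = card A) (\<lambda>X. I X \<and> card X = card A) A B"
proof -
  interpret matroid S I using M by (simp add: split_matroid_def)
  have AB: "A \<subseteq> S" "B \<subseteq> S" using A B indep_subset_ground by (auto simp: basis_def)
  have fin: "finite A" using AB finite_ground finite_subset by blast
  have part: "serial_exchange (\<lambda>X. I X \<and> card X = card (A \<inter> K)) (\<lambda>X. I X \<and> card X = card (A \<inter> K))
      (A \<inter> K) (B \<inter> K)" if K: "K \<in> components S I" for K
  proof -
    have "elementary_split_matroid K (restriction I K)"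
      using M K uniform_imp_elementary_split unfolding split_matroid_def by blast
    note elementary_split_serial_exchange[OF this basis_Int_component[OF A K] basis_Int_component[OF B K]]
    then show ?thesis unfolding serial_exchange_def restriction_def by blast
  qed
  have "serial_exchange (\<lambda>X. I X \<and> card X = card (A \<inter> \<Union>\<K>)) (\<lambda>X. I X \<and> card X = card (A \<inter> \<Union>\<K>))
      (A \<inter> \<Union>\<K>) (B \<inter> \<Union>\<K>)" if "finite \<K>" "\<K> \<subseteq> components S I" for \<K>
    using that
  proof (induction \<K> rule: finite_induct)
    case empty
    show ?case using indep_empty by (simp add: serial_exchange_refl)
  next
    case (insert K \<K>)
    have K: "K \<in> components S I" and \<K>: "\<K> \<subseteq> components S I" using insert.prems by auto
    have dis: "K \<inter> \<Union>\<K> = {}" using components_disjoint[OF K] \<K> insert.hyps(2) by blast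
    have eq: "A \<inter> \<Union>(insert K \<K>) = (A \<inter> K) \<union> (A \<inter> \<Union>\<K>)" "B \<inter> \<Union>(insert K \<K>) = (B \<inter> K) \<union> (B \<inter> \<Union>\<K>)"
      by auto
    have glue: "I (X \<union> Y) \<and> card (X \<union> Y) = card ((A \<inter> K) \<union> (A \<inter> \<Union>\<K>))"
      if X: "X \<subseteq> (A \<inter> K) \<union> (B \<inter> K)" "I X \<and> card X = card (A \<inter> K)"
        and Y: "Y \<subseteq> (A \<inter> \<Union>\<K>) \<union> (B \<inter> \<Union>\<K>)" "I Y \<and> card Y = card (A \<inter> \<Union>\<K>)" for X Y
    proof
      have XY: "X \<subseteq> K" "Y \<subseteq> \<Union>\<K>" using X Y by auto
      show "I (X \<union> Y)"
      proof (rule indep_Un_separated)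
        fix L assume L: "L \<in> components S I"
        show "X \<inter> L = {} \<or> Y \<inter> L = {}"
        proof (cases "L = K")
          case True
          then show ?thesis using XY dis by blast
        next
          case False
          then show ?thesis using XY components_disjoint[OF K L] by blast
        qed
      qed (use X Y in auto)
      have "X \<inter> Y = {}" "(A \<inter> K) \<inter> (A \<inter> \<Union>\<K>) = {}" using XY dis by auto
      then show "card (X \<union> Y) = card ((A \<inter> K) \<union> (A \<inter> \<Union>\<K>))"
        using X Y fin indep_finite by (simp add: card_Un_disjoint)
    qed
    show ?case unfolding eq
      by (rule serial_exchange_append[OF part[OF K] insert.IH[OF \<K>]]) (use dis glue in auto)
  qed
  from this[OF finite_components subset_refl] show ?thesis
    using AB by (simp add: Union_components Int_absorb2)
qed

theorem corollary14:
  fixes S :: "'a set" and I :: "'a set \<Rightarrow> bool" and r :: nat and A B :: "'a set"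
  assumes "split_matroid S I"
    and "matroid_rank I = r"
    and "basis I A"
    and "basis I B"
  shows "\<exists>a b :: nat \<Rightarrow> 'a.
    bij_betw a {1..r} A \<and> bij_betw b {1..r} B \<and>
    (\<forall>i\<in>{0..r}. basis I (a ` {1..i} \<union> b ` {i+1..r}) \<and>
                basis I (b ` {1..i} \<union> a ` {i+1..r}))"
proof -
  interpret matroid S I using assms(1) by (simp add: split_matroid_def)
  have r: "card A = r" using matroid_rank_eq_card_basis[OF assms(3)] assms(2) by simp
  obtain as bs where l: "distinct as" "distinct bs" "set as = A" "set bs = B" "length as = length bs"
    and ex: "\<And>t. t \<le> length as \<Longrightarrow> I (set (take t as) \<union> set (drop t bs)) \<and>
                card (set (take t as) \<union> set (drop t bs)) = card A"
      "\<And>t. t \<le> length as \<Longrightarrow> I (set (take t bs) \<union> set (drop t as)) \<and>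
                card (set (take t bs) \<union> set (drop t as)) = card A"
    using split_serial_exchange[OF assms(1,3,4)] unfolding serial_exchange_def by blast
  have len: "length as = r" "length bs = r" using l r distinct_card[of as] by auto
  \<comment> \<open>lists are indexed from 0, the orderings from 1\<close>
  have enum: "bij_betw (\<lambda>i. xs ! (i - 1)) {1..r} (set xs)"
    "\<And>i. i \<le> r \<Longrightarrow> (\<lambda>i. xs ! (i - 1)) ` {1..i} = set (take i xs)"
    "\<And>i. i \<le> r \<Longrightarrow> (\<lambda>i. xs ! (i - 1)) ` {i+1..r} = set (drop i xs)"
    if xs: "distinct xs" "length xs = r" for xs :: "'a list"
  proof -
    have shift: "bij_betw (\<lambda>i. i - 1) {1..r} {..<r}"
      by (rule bij_betw_byWitness[where f' = Suc]) auto
    have "bij_betw ((!) xs \<circ> (\<lambda>i. i - 1)) {1..r} (set xs)"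
      using bij_betw_trans[OF shift bij_betw_nth[OF xs(1), of "{..<r}" "set xs"]] xs(2) by simp
    then show "bij_betw (\<lambda>i. xs ! (i - 1)) {1..r} (set xs)" by (simp add: comp_def)
    fix i assume i: "i \<le> r"
    have "(\<lambda>i. i - 1) ` {1..i} = {..<i}" by (force simp: image_iff intro: bexI[of _ "Suc _"])
    then have "(\<lambda>i. xs ! (i - 1)) ` {1..i} = (!) xs ` {..<i}" by (metis image_image)
    then show "(\<lambda>i. xs ! (i - 1)) ` {1..i} = set (take i xs)"
      using nth_image[of i xs] i xs(2) by (simp add: atLeast0LessThan)
    have "(\<lambda>k. xs ! (k - 1)) ` {i+1..r} = (\<lambda>k. xs ! (i + k)) ` {..<r - i}"
    proof -
      have "{i+1..r} = (\<lambda>k. Suc (i + k)) ` {..<r - i}"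
      proof (intro set_eqI iffI)
        fix k assume "k \<in> {i+1..r}"
        then show "k \<in> (\<lambda>k. Suc (i + k)) ` {..<r - i}" by (intro image_eqI[of _ _ "k - Suc i"]) auto
      qed auto
      then show ?thesis by (simp only: image_image) simp
    qed
    also have "\<dots> = set (drop i xs)"
      using xs(2) i by (auto simp: set_conv_nth image_iff)
    finally show "(\<lambda>i. xs ! (i - 1)) ` {i+1..r} = set (drop i xs)" .
  qed
  show ?thesis
  proof (intro exI conjI ballI)
    show "bij_betw (\<lambda>i. as ! (i - 1)) {1..r} A" using enum(1)[OF l(1) len(1)] l(3) by simp
    show "bij_betw (\<lambda>i. bs ! (i - 1)) {1..r} B" using enum(1)[OF l(2) len(2)] l(4) by simp
    fix i assume "i \<in> {0..r}"
    then have i: "i \<le> r" by simp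
    note e = enum(2,3)[OF l(1) len(1) i] enum(2,3)[OF l(2) len(2) i]
    show "basis I ((\<lambda>i. as ! (i - 1)) ` {1..i} \<union> (\<lambda>i. bs ! (i - 1)) ` {i+1..r})"
      unfolding e using ex(1)[of i] i len basis_if_card_basis[OF assms(3)] by blast
    show "basis I ((\<lambda>i. bs ! (i - 1)) ` {1..i} \<union> (\<lambda>i. as ! (i - 1)) ` {i+1..r})"
      unfolding e using ex(2)[of i] i len basis_if_card_basis[OF assms(3)] by blast
  qed
qed

end
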